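(* Let $a,b\in\mathbb Z$ be such that $F(x)=x^4+ax^2+b$ is irreducible over $\mathbb Q$, and assume that for every prime $p$ we have $\nu_p(a)<2$ or $\nu_p(b)<4$. Let $\alpha$ be a root of $F(x)$ and $K=\mathbb Q(\alpha)$. Then $3$ divides $i(K)$ if and only if one of the following holds: (1) $a\equiv -1\pmod 3$, $\nu_3(b)=2k$ for some positive integer $k$, and $b_3\equiv 1\pmod 3$; (2) $a\equiv b\equiv 1\pmod 3$, $\nu_3(a^2-4b)=2k$ for some positive integer $k$, and $(a^2-4b)_3\equiv 1\pmod 3$. In particular, if one of these conditions holds, then $K$ is not monogenic, and in all these cases $\nu_3(i(K))=1$.
   Context: $\nu_p$ denotes the $p$-adic valuation, and for a nonzero integer $c$, $c_3=c/3^{\nu_3(c)}$. The index $i(K)$ of a number field $K$ is the greatest common divisor of the indices $(\mathbb Z_K:\mathbb Z[\theta])$ over all $\theta\in\mathbb Z_K$ with $K=\mathbb Q(\theta)$, where $\mathbb Z_K$ is the ring of integers. $K$ is monogenic if $\mathbb Z_K=\mathbb Z[\theta]$ for some $\theta\in\mathbb Z_K$. *)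

theory Defs
  imports Complex_Main "HOL-Library.Extended_Nat" "HOL-Computational_Algebra.Computational_Algebra"
    "HOL-Number_Theory.Cong" "HOL-Algebra.Algebraic_Closure_Type" "HOL-Algebra.Generated_Fields"
begin

text \<open>
  Number fields are represented as subfields of the complex numbers. The type
  \<^typ>\<open>complex\<close> is viewed as a ring in the sense of HOL-Algebra, so that generated subfields,
  generated subrings and cosets are those of that library.
\<close>

abbreviation complex_ring :: "complex ring"
  where "complex_ring \<equiv> ring_of_type_algebra"

definition rat_adjoin :: "complex \<Rightarrow> complex set"
  where "rat_adjoin \<theta> = generate_field complex_ring {\<theta>}"

definition int_adjoin :: "complex \<Rightarrow> complex set"
  where "int_adjoin \<theta> = generate_ring complex_ring {\<theta>}"

definition ring_of_integers :: "complex set \<Rightarrow> complex set"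
  where "ring_of_integers K = {x \<in> K. algebraic_int x}"

text \<open>
  The index of the additive group \<open>\<int>[\<theta>]\<close> in the ring of integers of \<open>K\<close>. It is finite whenever
  \<open>\<theta>\<close> is an algebraic integer and \<open>K = \<rat>(\<theta>)\<close>, so the value \<open>0\<close> that \<^const>\<open>card\<close> gives to
  infinite sets does not enter the gcd below.
\<close>

definition index_of :: "complex set \<Rightarrow> complex \<Rightarrow> nat"
  where "index_of K \<theta> =
    card (a_rcosets\<^bsub>complex_ring\<lparr>carrier := ring_of_integers K\<rparr>\<^esub> (int_adjoin \<theta>))"

definition field_index :: "complex set \<Rightarrow> nat"
  where "field_index K = Gcd {index_of K \<theta> | \<theta>. \<theta> \<in> ring_of_integers K \<and> K = rat_adjoin \<theta>}"

definition monogenic :: "complex set \<Rightarrow> bool"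
  where "monogenic K \<longleftrightarrow> (\<exists>\<theta> \<in> ring_of_integers K. ring_of_integers K = int_adjoin \<theta>)"

text \<open>
  The library has \<open>multiplicity p 0 = 0\<close>, whereas the \<open>p\<close>-adic valuation of \<open>0\<close> is infinite.
\<close>

definition padic_val :: "nat \<Rightarrow> int \<Rightarrow> enat"  (\<open>\<nu>\<close>)
  where "\<nu> p c = (if c = 0 then \<infinity> else enat (multiplicity (int p) c))"

text \<open>\<open>c\<^sub>p = c / p\<^bsup>\<nu>\<^sub>p(c)\<^esup>\<close>, for nonzero \<open>c\<close>.\<close>

definition unit_part :: "nat \<Rightarrow> int \<Rightarrow> int"
  where "unit_part p c = c div int p ^ multiplicity (int p) c"

definition index_cond1 :: "int \<Rightarrow> int \<Rightarrow> bool"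
  where "index_cond1 a b \<longleftrightarrow>
    [a = -1] (mod 3) \<and> (\<exists>k::nat. k > 0 \<and> \<nu> 3 b = enat (2 * k)) \<and> [unit_part 3 b = 1] (mod 3)"

definition index_cond2 :: "int \<Rightarrow> int \<Rightarrow> bool"
  where "index_cond2 a b \<longleftrightarrow>
    [a = b] (mod 3) \<and> [b = 1] (mod 3) \<and>
    (\<exists>k::nat. k > 0 \<and> \<nu> 3 (a\<^sup>2 - 4 * b) = enat (2 * k)) \<and>
    [unit_part 3 (a\<^sup>2 - 4 * b) = 1] (mod 3)"

end

theory Submission
  imports Defs "Jordan_Normal_Form.Char_Poly" "HOL-Algebra.Sylow"
begin

text \<open>
  Write \<open>a\<^sup>2 - 4b = 9\<^sup>j m\<close> with \<open>m\<close> not divisible by \<open>9\<close>, and put \<open>\<epsilon> = (2\<alpha>\<^sup>2 + a) / 3\<^sup>j\<close>, so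
  that \<open>\<epsilon>\<^sup>2 = m\<close>. Multiplying \<open>\<alpha>\<close> by a suitable element of \<open>\<rat>(\<epsilon>)\<close> gives \<open>\<eta>\<close> with
  \<open>\<eta>\<^sup>2 = s + t \<epsilon>\<close>, where \<open>s, t\<close> are integers and \<open>\<eta>\<^sup>2\<close> has no
  square factor at the places over \<open>3\<close>; then \<open>\<int>[\<epsilon>, \<eta>]\<close> is maximal at \<open>3\<close>. Modulo \<open>3\<close> this order is
  \<open>(\<int>/3)\<^sup>4\<close> exactly when \<open>m \<equiv> s \<equiv> 1\<close> and \<open>t \<equiv> 0\<close>. In that case two of the four homomorphisms to \<open>\<int>/3\<close>
  agree on any given \<open>\<theta>\<close>, so \<open>\<int>[\<theta>]\<close> always has index divisible by \<open>3\<close>, while some \<open>\<theta> = p \<epsilon> + \<eta>\<close> has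
  index not divisible by \<open>9\<close>. Otherwise one of \<open>\<eta>\<close>, \<open>\<epsilon> + \<eta>\<close>, \<open>(1 + \<epsilon>) \<eta>\<close> has index prime to \<open>3\<close>.
\<close>

section \<open>Sums and products of algebraic integers\<close>

text \<open>The difficulty is maximality at 3. When 9 divides \<open>b\<close>,
  \<open>\<alpha>\<^sup>2\<close> can have a square factor at a place over 3. If moreover 3 does not
  divide \<open>a\<close>, this happens at one of two places only, and dividing
  \<open>\<alpha>\<close> by a power of 3 cannot remove it; hence the multipliers
  \<open>x + y * \<epsilon>\<close>. The valuation hypothesis at the prime 3 says that 9 divides
  \<open>a\<close> and 81 divides \<open>b\<close> do not both hold; if they did,
  \<open>\<alpha> / 3\<close> would still be integral. Because 2 is invertible modulo 3, an integer
  \<open>A + B * \<eta>\<close> of K can be tested at 3 through \<open>2 * A\<close> and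
  \<open>2 * B * \<eta>\<close>, and the factors 2 put into \<open>\<epsilon>\<close> and
  \<open>\<eta>\<close> to keep \<open>m\<close>, \<open>s\<close>, \<open>t\<close> integral are
  harmless. Square factors of \<open>\<eta>\<^sup>2\<close> are detected by its norm
  \<open>s\<^sup>2 - m * t\<^sup>2\<close>. Indices are not computed: that 3 or 9 does not divide
  one follows from a bound on the torsion of the additive quotient by Z[\<theta>].\<close>

lemma algebraic_int_if_mult_matrix:
  fixes x :: "'a :: field_char_0"
  assumes fin: "finite V" and v: "v \<in> V" "v \<noteq> 0"
    and c: "\<And>v. v \<in> V \<Longrightarrow> x * v = (\<Sum>w\<in>V. of_int (c v w) * w)"
  shows "algebraic_int x"
proof -
  obtain f where f: "bij_betw f {0..<card V} V"
    using ex_bij_betw_nat_finite[OF fin] by blast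
  define n where "n = card V"
  define A :: "int mat" where "A = mat n n (\<lambda>(i, j). c (f i) (f j))"
  have A: "A \<in> carrier_mat n n" by (simp add: A_def)
  let ?A = "map_mat of_int A :: 'a mat"
  have fV: "f i \<in> V" if "i < n" for i
    using f that by (auto simp: bij_betw_def n_def)
  \<comment> \<open>The elements of \<open>V\<close>, listed as a vector, form an eigenvector for
    the eigenvalue x, so x is a root of the monic integral characteristic polynomial.\<close>
  have "?A *\<^sub>v vec n f = x \<cdot>\<^sub>v vec n f"
  proof (rule eq_vecI)
    fix i assume "i < dim_vec (x \<cdot>\<^sub>v vec n f)"
    hence i: "i < n" by simp
    have "(?A *\<^sub>v vec n f) $ i = (\<Sum>j\<in>{0..<n}. of_int (c (f i) (f j)) * f j)"
      using i by (simp add: A_def scalar_prod_def)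
    also have "\<dots> = (\<Sum>w\<in>V. of_int (c (f i) w) * w)"
      by (rule sum.reindex_bij_betw[OF f[folded n_def], where g = "\<lambda>w. of_int (c (f i) w) * w"])
    also have "\<dots> = x * f i" using c[OF fV[OF i]] by simp
    finally show "(?A *\<^sub>v vec n f) $ i = (x \<cdot>\<^sub>v vec n f) $ i" using i by simp
  qed (simp add: A_def)
  moreover have "vec n f \<noteq> 0\<^sub>v n"
  proof
    obtain i where "i < n" "f i = v"
      using f v by (metis atLeastLessThan_iff bij_betw_def imageE n_def)
    moreover assume "vec n f = 0\<^sub>v n"
    ultimately have "v = 0" by (metis index_vec index_zero_vec(1))
    thus False using v by simp
  qed
  ultimately have "eigenvalue ?A x"
    unfolding eigenvalue_def eigenvector_def using A by (intro exI[of _ "vec n f"]) auto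
  hence "poly (char_poly ?A) x = 0"
    using A by (subst (asm) eigenvalue_root_char_poly[of _ n]) auto
  hence "poly (map_poly of_int (char_poly A)) x = 0"
    by (simp add: of_int_hom.char_poly_hom[OF A])
  moreover have "lead_coeff (char_poly A) = 1"
    using degree_monic_char_poly[OF A] by auto
  ultimately show ?thesis
    unfolding algebraic_int_altdef_ipoly by blast
qed

definition zspan :: "'a :: ring_1 set \<Rightarrow> 'a set"
  where "zspan V = {\<Sum>w\<in>V. of_int (c w) * w | c. True}"

lemma zspan_add: "a \<in> zspan V \<Longrightarrow> b \<in> zspan V \<Longrightarrow> a + b \<in> zspan V"
  unfolding zspan_def
proof safe
  fix c d :: "'a \<Rightarrow> int"
  show "\<exists>e. (\<Sum>w\<in>V. of_int (c w) * w) + (\<Sum>w\<in>V. of_int (d w) * w) = (\<Sum>w\<in>V. of_int (e w) * w) \<and> True"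
    by (rule exI[of _ "\<lambda>w. c w + d w"]) (simp add: sum.distrib algebra_simps)
qed

lemma zspan_scale: "a \<in> zspan V \<Longrightarrow> of_int k * a \<in> zspan V"
  unfolding zspan_def
proof safe
  fix c :: "'a \<Rightarrow> int"
  show "\<exists>e. of_int k * (\<Sum>w\<in>V. of_int (c w) * w) = (\<Sum>w\<in>V. of_int (e w) * w) \<and> True"
    by (rule exI[of _ "\<lambda>w. k * c w"]) (simp add: sum_distrib_left algebra_simps)
qed

lemma zspan_0: "0 \<in> zspan V"
  unfolding zspan_def by (auto intro!: exI[of _ "\<lambda>_. 0"])

lemma zspan_sum: "(\<And>i. i \<in> I \<Longrightarrow> g i \<in> zspan V) \<Longrightarrow> sum g I \<in> zspan V"
  by (induction I rule: infinite_finite_induct) (auto intro: zspan_0 zspan_add)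

lemma zspan_base: "finite V \<Longrightarrow> v \<in> V \<Longrightarrow> v \<in> zspan V"
  unfolding zspan_def
  by (auto intro!: exI[of _ "\<lambda>w. if w = v then 1 else 0"] simp: if_distribR if_distrib
      cong: if_cong)

lemma zspan_mult:
  fixes x :: "'a :: comm_ring_1"
  assumes "\<And>v. v \<in> V \<Longrightarrow> x * v \<in> zspan V" "a \<in> zspan V"
  shows "x * a \<in> zspan V"
proof -
  obtain c where "a = (\<Sum>w\<in>V. of_int (c w) * w)" using assms(2) by (auto simp: zspan_def)
  hence "x * a = (\<Sum>w\<in>V. of_int (c w) * (x * w))"
    by (simp add: sum_distrib_left mult_ac)
  also have "\<dots> \<in> zspan V" by (intro zspan_sum zspan_scale assms(1))
  finally show ?thesis .
qed

lemma algebraic_int_if_zspan: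
  fixes x :: "'a :: field_char_0"
  assumes "finite V" and "v \<in> V" "v \<noteq> 0" and "\<And>v. v \<in> V \<Longrightarrow> x * v \<in> zspan V"
  shows "algebraic_int x"
proof -
  have "\<exists>c. x * v = (\<Sum>w\<in>V. of_int (c w) * w)" if "v \<in> V" for v
    using assms(4)[OF that] by (auto simp: zspan_def)
  then obtain c where "\<And>v. v \<in> V \<Longrightarrow> x * v = (\<Sum>w\<in>V. of_int (c v w) * w)" by metis
  thus ?thesis using algebraic_int_if_mult_matrix[OF assms(1-3)] by blast
qed

lemma algebraic_int_power_reduce:
  fixes x :: "'a :: field_char_0"
  assumes "algebraic_int x"
  obtains n and c :: "nat \<Rightarrow> int" where "n > 0" "x ^ n = (\<Sum>i<n. of_int (c i) * x ^ i)"
proof -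
  obtain p where p: "poly (map_poly of_int p) x = 0" "lead_coeff p = 1"
    using assms by (auto simp: algebraic_int_altdef_ipoly)
  define n where "n = degree p"
  have "n > 0"
  proof (rule ccontr)
    assume "\<not> n > 0"
    then obtain c where "p = [:c:]" by (auto simp: n_def elim: degree_eq_zeroE)
    with p show False by (simp add: map_poly_pCons)
  qed
  have "0 = (\<Sum>i\<le>n. of_int (coeff p i) * x ^ i)"
    using p(1) by (simp add: poly_altdef n_def degree_map_poly coeff_map_poly)
  also have "\<dots> = (\<Sum>i<n. of_int (coeff p i) * x ^ i) + x ^ n"
    using p(2) by (simp add: n_def flip: lessThan_Suc_atMost)
  finally have "x ^ n = (\<Sum>i<n. of_int (- coeff p i) * x ^ i)"
    by (simp add: sum_negf add_eq_0_iff)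
  with \<open>n > 0\<close> show ?thesis by (rule that)
qed

text \<open>The products x^i y^j, with exponents below the degrees of monic equations of x and y,
  span a module stable under both, hence under x + y and x y.\<close>

lemma algebraic_int_common_module:
  fixes x y :: "'a :: field_char_0"
  assumes "algebraic_int x" "algebraic_int y"
  obtains V where "finite V" "1 \<in> V"
    "\<And>v. v \<in> V \<Longrightarrow> x * v \<in> zspan V" "\<And>v. v \<in> V \<Longrightarrow> y * v \<in> zspan V"
proof -
  obtain n c where n: "n > 0" "x ^ n = (\<Sum>i<n. of_int (c i :: int) * x ^ i)"
    using algebraic_int_power_reduce[OF assms(1)] by blast
  obtain m d where m: "m > 0" "y ^ m = (\<Sum>i<m. of_int (d i :: int) * y ^ i)"
    using algebraic_int_power_reduce[OF assms(2)] by blast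
  define V where "V = (\<lambda>(i, j). x ^ i * y ^ j) ` ({..<n} \<times> {..<m})"
  have fin: "finite V" by (simp add: V_def)
  have V: "x ^ i * y ^ j \<in> zspan V" if "i < n" "j < m" for i j
    using that by (intro zspan_base fin) (auto simp: V_def)
  have "x * (x ^ i * y ^ j) \<in> zspan V" if ij: "i < n" "j < m" for i j
  proof (cases "Suc i < n")
    case True
    thus ?thesis using V[of "Suc i" j] ij by (simp add: mult_ac)
  next
    case False
    hence "Suc i = n" using ij by simp
    hence "x * (x ^ i * y ^ j) = x ^ n * y ^ j" by auto
    also have "\<dots> = (\<Sum>k<n. of_int (c k) * (x ^ k * y ^ j))"
      unfolding n(2) by (simp add: sum_distrib_right mult.assoc)
    also have "\<dots> \<in> zspan V" by (intro zspan_sum zspan_scale V) (use ij in auto)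
    finally show ?thesis .
  qed
  moreover have "y * (x ^ i * y ^ j) \<in> zspan V" if ij: "i < n" "j < m" for i j
  proof (cases "Suc j < m")
    case True
    thus ?thesis using V[of i "Suc j"] ij by (simp add: mult_ac)
  next
    case False
    hence "Suc j = m" using ij by simp
    hence "y * (x ^ i * y ^ j) = x ^ i * y ^ m" by auto
    also have "\<dots> = (\<Sum>k<m. of_int (d k) * (x ^ i * y ^ k))"
      unfolding m(2) by (simp add: sum_distrib_left mult.left_commute)
    also have "\<dots> \<in> zspan V" by (intro zspan_sum zspan_scale V) (use ij in auto)
    finally show ?thesis .
  qed
  moreover have "1 \<in> V"
    unfolding V_def using n(1) m(1) by (intro image_eqI[of _ _ "(0, 0)"]) auto
  ultimately show ?thesis using fin by (intro that[of V]) (auto simp: V_def)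
qed

lemma
  fixes x y :: "'a :: field_char_0"
  assumes "algebraic_int x" "algebraic_int y"
  shows algebraic_int_plus: "algebraic_int (x + y)"
    and algebraic_int_times: "algebraic_int (x * y)"
proof -
  obtain V where V: "finite V" "1 \<in> V"
    "\<And>v. v \<in> V \<Longrightarrow> x * v \<in> zspan V" "\<And>v. v \<in> V \<Longrightarrow> y * v \<in> zspan V"
    using algebraic_int_common_module[OF assms] by blast
  show "algebraic_int (x + y)"
    by (rule algebraic_int_if_zspan[OF V(1,2)]) (auto simp: distrib_right intro!: zspan_add V)
  show "algebraic_int (x * y)"
    by (rule algebraic_int_if_zspan[OF V(1,2)])
       (auto simp: mult.assoc intro: zspan_mult[of V x] V)
qed

lemma algebraic_int_diff:
  fixes x y :: "'a :: field_char_0"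
  shows "algebraic_int x \<Longrightarrow> algebraic_int y \<Longrightarrow> algebraic_int (x - y)"
  using algebraic_int_plus[of x "-y"] by (simp add: algebraic_int_minus)

section \<open>Cosets, subfields and quadratic extensions\<close>

text \<open>Sylow's theorem gives a subgroup of order \<open>p ^ a\<close> in the quotient for every
  such divisor of its order, not only the maximal one. \<open>T\<close> picks one representative of
  each coset in it, and Lagrange gives the torsion property.\<close>

lemma (in comm_group) ex_torsion_transversal:
  assumes H: "subgroup H G" and fin: "finite (rcosets H)"
    and p: "Factorial_Ring.prime p" and dvd: "p ^ a dvd card (rcosets H)"
  obtains T where "T \<subseteq> carrier G" "card T = p ^ a"
    "\<And>x. x \<in> T \<Longrightarrow> x [^] (p ^ a) \<in> H"
    "\<And>x y. x \<in> T \<Longrightarrow> y \<in> T \<Longrightarrow> x \<otimes> inv y \<in> H \<Longrightarrow> x = y"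
proof -
  have norm: "H \<lhd> G" by (rule subgroup_imp_normal[OF H])
  interpret Q: group "G Mod H" by (rule normal.factorgroup_is_group[OF norm])
  interpret h: group_hom G "G Mod H" "\<lambda>x. H #> x"
    using normal.r_coset_hom_Mod[OF norm] Q.group_axioms group_axioms
    by (simp add: group_hom_def group_hom_axioms_def)
  have car: "carrier (G Mod H) = rcosets H" by (simp add: FactGroup_def)
  obtain m where m: "card (rcosets H) = p ^ a * m" using dvd by auto
  obtain S where S: "subgroup S (G Mod H)" "card S = p ^ a"
    using sylow_thm[OF p Q.group_axioms, of a m] fin m by (auto simp: Coset.order_def car)
  interpret S: group "(G Mod H)\<lparr>carrier := S\<rparr>" by (rule Q.subgroup_imp_group[OF S(1)])
  have SC: "S \<subseteq> rcosets H" using subgroup.subset[OF S(1)] car by simp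
  have "\<exists>x\<in>carrier G. c = H #> x" if "c \<in> S" for c
    using that SC by (auto simp: RCOSETS_def)
  then obtain f where f: "\<And>c. c \<in> S \<Longrightarrow> f c \<in> carrier G" "\<And>c. c \<in> S \<Longrightarrow> c = H #> f c"
    by metis
  have inj: "inj_on f S" using f(2) by (metis inj_onI)
  have coset_H: "y \<in> H" if "y \<in> carrier G" "H #> y = H" for y
    using that rcos_self[OF that(1) H] by simp
  show ?thesis
  proof (rule that[of "f ` S"])
    show "f ` S \<subseteq> carrier G" using f by auto
    show "card (f ` S) = p ^ a" using S inj by (simp add: card_image)
  next
    fix x assume "x \<in> f ` S"
    then obtain c where c: "c \<in> S" "x = f c" by auto
    have "c [^]\<^bsub>G Mod H\<^esub> (p ^ a) = \<one>\<^bsub>G Mod H\<^esub>"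
      using S.pow_order_eq_1[of c] c S(2) by (simp add: Coset.order_def flip: Q.nat_pow_consistent)
    moreover have "H #> (x [^] (p ^ a)) = c [^]\<^bsub>G Mod H\<^esub> (p ^ a)"
      using h.hom_nat_pow[of x "p ^ a"] f c by simp
    ultimately show "x [^] (p ^ a) \<in> H"
      using f c by (intro coset_H) (auto simp: FactGroup_def)
  next
    fix x y assume "x \<in> f ` S" "y \<in> f ` S" and xy: "x \<otimes> inv y \<in> H"
    then obtain c d where cd: "c \<in> S" "x = f c" "d \<in> S" "y = f d" by auto
    have "x \<in> H #> y"
    proof -
      have "x = (x \<otimes> inv y) \<otimes> y" using f cd by (simp add: m_assoc)
      thus ?thesis using xy unfolding r_coset_def by blast
    qed
    hence "H #> y = H #> x" by (rule repr_independence) (use f cd H in auto)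
    thus "x = y" using f cd by metis
  qed
qed

lemma (in comm_group) pow_index_mem:
  assumes H: "subgroup H G" and fin: "finite (rcosets H)" and x: "x \<in> carrier G"
  shows "x [^] card (rcosets H) \<in> H"
proof -
  have norm: "H \<lhd> G" by (rule subgroup_imp_normal[OF H])
  interpret Q: group "G Mod H" by (rule normal.factorgroup_is_group[OF norm])
  interpret h: group_hom G "G Mod H" "\<lambda>x. H #> x"
    using normal.r_coset_hom_Mod[OF norm] Q.group_axioms group_axioms
    by (simp add: group_hom_def group_hom_axioms_def)
  have "(H #> x) [^]\<^bsub>G Mod H\<^esub> Coset.order (G Mod H) = \<one>\<^bsub>G Mod H\<^esub>"
    by (rule Q.pow_order_eq_1) (use h.hom_closed[OF x] in simp)
  hence "H #> (x [^] card (rcosets H)) = H"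
    using h.hom_nat_pow[OF x, of "card (rcosets H)"] by (simp add: Coset.order_def FactGroup_def)
  thus ?thesis using rcos_self[of "x [^] card (rcosets H)" H] x H by simp
qed

section \<open>Subfields of the complex numbers and subrings generated by one element\<close>

lemma complex_ring_simps [simp]:
  "carrier complex_ring = UNIV" "x \<otimes>\<^bsub>complex_ring\<^esub> y = x * y" "x \<oplus>\<^bsub>complex_ring\<^esub> y = x + y"
  "\<one>\<^bsub>complex_ring\<^esub> = 1" "\<zero>\<^bsub>complex_ring\<^esub> = 0"
  by (simp_all add: ring_of_type_algebra_def)

lemma complex_ring_a_inv [simp]: "\<ominus>\<^bsub>complex_ring\<^esub> x = - x"
proof -
  interpret ring complex_ring by (rule ring_from_type_algebra)
  show ?thesis using minus_equality[of "-x" x] by simp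
qed

lemma complex_ring_m_inv: "x \<noteq> 0 \<Longrightarrow> inv\<^bsub>complex_ring\<^esub> x = inverse x"
proof -
  interpret field complex_ring by (rule field_from_type_algebra)
  show "x \<noteq> 0 \<Longrightarrow> inv\<^bsub>complex_ring\<^esub> x = inverse x"
    by (rule comm_inv_char) auto
qed

locale sub_field =
  fixes F :: "'a :: field_char_0 set"
  assumes one: "1 \<in> F" and diff: "x \<in> F \<Longrightarrow> y \<in> F \<Longrightarrow> x - y \<in> F"
    and mult: "x \<in> F \<Longrightarrow> y \<in> F \<Longrightarrow> x * y \<in> F" and inv: "x \<in> F \<Longrightarrow> inverse x \<in> F"
begin

lemma zero: "0 \<in> F" using diff[OF one one] by simp
lemma uminus: "x \<in> F \<Longrightarrow> - x \<in> F" using diff[OF zero] by force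
lemma add: "x \<in> F \<Longrightarrow> y \<in> F \<Longrightarrow> x + y \<in> F" using diff[of x "-y"] uminus by simp
lemma divide: "x \<in> F \<Longrightarrow> y \<in> F \<Longrightarrow> x / y \<in> F" using mult inv by (simp add: field_class.field_divide_inverse)
lemma power: "x \<in> F \<Longrightarrow> x ^ n \<in> F" by (induction n) (auto intro: one mult)
lemma of_nat: "of_nat n \<in> F" by (induction n) (auto intro: zero one add)
lemma of_int: "of_int k \<in> F" by (cases k) (use of_nat uminus in \<open>auto simp del: of_nat_Suc\<close>)
lemma numeral: "numeral n \<in> F" using of_nat[of "numeral n"] by simp
lemma Rats: "\<rat> \<subseteq> F" by (auto elim!: Rats_cases' intro: divide of_int)

lemmas closed = zero one uminus add diff mult inv divide power of_nat of_int numeral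

end

lemma sub_field_Rats: "sub_field (\<rat> :: 'a :: field_char_0 set)"
  by unfold_locales auto

lemma sub_field_rat_adjoin: "sub_field (rat_adjoin \<theta>)"
proof
  have add: "x + y \<in> rat_adjoin \<theta>" if "x \<in> rat_adjoin \<theta>" "y \<in> rat_adjoin \<theta>" for x y
    using generate_field.eng_add[of x complex_ring "{\<theta>}" y] that by (simp add: rat_adjoin_def)
  have uminus: "- x \<in> rat_adjoin \<theta>" if "x \<in> rat_adjoin \<theta>" for x
    using generate_field.a_inv[of x complex_ring "{\<theta>}"] that by (simp add: rat_adjoin_def)
  show one: "1 \<in> rat_adjoin \<theta>"
    using generate_field.one[of complex_ring "{\<theta>}"] by (simp add: rat_adjoin_def)
  show diff: "x - y \<in> rat_adjoin \<theta>" if "x \<in> rat_adjoin \<theta>" "y \<in> rat_adjoin \<theta>" for x y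
    using add[of x "-y"] uminus that by simp
  show "x * y \<in> rat_adjoin \<theta>" if "x \<in> rat_adjoin \<theta>" "y \<in> rat_adjoin \<theta>" for x y
    using generate_field.eng_mult[of x complex_ring "{\<theta>}" y] that by (simp add: rat_adjoin_def)
  show "inverse x \<in> rat_adjoin \<theta>" if x: "x \<in> rat_adjoin \<theta>" for x
  proof (cases "x = 0")
    case True
    thus ?thesis using diff[OF one one] by simp
  next
    case False
    thus ?thesis using generate_field.m_inv[of x complex_ring "{\<theta>}"] x
      by (simp add: rat_adjoin_def complex_ring_m_inv)
  qed
qed

lemma mem_rat_adjoin: "\<theta> \<in> rat_adjoin \<theta>"
  unfolding rat_adjoin_def by (rule generate_field.incl) simp

lemma rat_adjoin_subset:
  assumes "sub_field F" "\<theta> \<in> F"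
  shows "rat_adjoin \<theta> \<subseteq> F"
proof
  interpret sub_field F by fact
  fix x assume "x \<in> rat_adjoin \<theta>"
  thus "x \<in> F" unfolding rat_adjoin_def
    by (induction rule: generate_field.induct) (auto simp: complex_ring_m_inv assms(2) intro: closed)
qed

lemma int_adjoin_closed:
  shows int_adjoin_1: "1 \<in> int_adjoin \<theta>"
    and int_adjoin_self: "\<theta> \<in> int_adjoin \<theta>"
    and int_adjoin_uminus: "x \<in> int_adjoin \<theta> \<Longrightarrow> - x \<in> int_adjoin \<theta>"
    and int_adjoin_add: "x \<in> int_adjoin \<theta> \<Longrightarrow> y \<in> int_adjoin \<theta> \<Longrightarrow> x + y \<in> int_adjoin \<theta>"
    and int_adjoin_mult: "x \<in> int_adjoin \<theta> \<Longrightarrow> y \<in> int_adjoin \<theta> \<Longrightarrow> x * y \<in> int_adjoin \<theta>"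
  using generate_ring.intros[where R = complex_ring and H = "{\<theta>}"]
  by (simp_all add: int_adjoin_def)

lemma int_adjoin_diff: "x \<in> int_adjoin \<theta> \<Longrightarrow> y \<in> int_adjoin \<theta> \<Longrightarrow> x - y \<in> int_adjoin \<theta>"
  using int_adjoin_add[of x \<theta> "-y"] int_adjoin_uminus by simp

lemma int_adjoin_0: "0 \<in> int_adjoin \<theta>"
  using int_adjoin_diff[OF int_adjoin_1 int_adjoin_1] by simp

lemma int_adjoin_of_nat: "of_nat n \<in> int_adjoin \<theta>"
  by (induction n) (auto intro: int_adjoin_0 int_adjoin_1 int_adjoin_add)

lemma int_adjoin_of_int: "of_int k \<in> int_adjoin \<theta>"
  by (cases k) (use int_adjoin_of_nat int_adjoin_uminus in \<open>auto simp del: of_nat_Suc\<close>)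

lemma int_adjoin_numeral: "numeral n \<in> int_adjoin \<theta>"
  using int_adjoin_of_nat[of "numeral n"] by simp

lemma int_adjoin_power: "x \<in> int_adjoin \<theta> \<Longrightarrow> x ^ n \<in> int_adjoin \<theta>"
  by (induction n) (auto intro: int_adjoin_1 int_adjoin_mult)

lemmas int_adjoin_intros = int_adjoin_0 int_adjoin_closed int_adjoin_diff int_adjoin_of_nat
  int_adjoin_of_int int_adjoin_numeral int_adjoin_power

lemma int_adjoin_induct [consumes 1, case_names one self uminus add mult]:
  assumes "x \<in> int_adjoin \<theta>" and "P 1" "P \<theta>" "\<And>x. P x \<Longrightarrow> P (- x)"
    "\<And>x y. P x \<Longrightarrow> P y \<Longrightarrow> P (x + y)" "\<And>x y. P x \<Longrightarrow> P y \<Longrightarrow> P (x * y)"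
  shows "P x"
  using assms(1) unfolding int_adjoin_def
  by (induction rule: generate_ring.induct) (use assms in auto)

section \<open>Quadratic extensions and their conjugation\<close>

definition quad_ext :: "'a :: field_char_0 set \<Rightarrow> 'a \<Rightarrow> 'a set"
  where "quad_ext F e = {A + B * e | A B. A \<in> F \<and> B \<in> F}"

lemma quad_extI: "A \<in> F \<Longrightarrow> B \<in> F \<Longrightarrow> A + B * e \<in> quad_ext F e"
  by (auto simp: quad_ext_def)

locale quadratic_ext = sub_field F for F :: "'a :: field_char_0 set" +
  fixes e :: 'a
  assumes square: "e\<^sup>2 \<in> F" and notin: "e \<notin> F"
begin

lemma eq_0: "A \<in> F \<Longrightarrow> B \<in> F \<Longrightarrow> A + B * e = 0 \<Longrightarrow> A = 0 \<and> B = 0"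
proof -
  assume AB: "A \<in> F" "B \<in> F" and eq: "A + B * e = 0"
  have "B = 0"
  proof (rule ccontr)
    assume "B \<noteq> 0"
    hence "e = - A / B" using eq by (simp add: field_simps add_eq_0_iff)
    thus False using AB notin by (auto intro: closed)
  qed
  thus ?thesis using eq by simp
qed

lemma norm_neq_0:
  assumes "A \<in> F" "B \<in> F" "A + B * e \<noteq> 0"
  shows "A\<^sup>2 - B\<^sup>2 * e\<^sup>2 \<noteq> 0"
proof
  assume "A\<^sup>2 - B\<^sup>2 * e\<^sup>2 = 0"
  hence "(A + B * e) * (A + (- B) * e) = 0" by (simp add: algebra_simps power2_eq_square)
  hence "A + (- B) * e = 0" using assms by simp
  thus False using eq_0[of A "-B"] assms by (auto intro: closed)
qed

lemma sub_field_quad_ext: "sub_field (quad_ext F e)"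
proof
  show "1 \<in> quad_ext F e" using quad_extI[OF one zero] by simp
  fix x assume "x \<in> quad_ext F e"
  then obtain A B where x: "x = A + B * e" "A \<in> F" "B \<in> F" by (auto simp: quad_ext_def)
  show "inverse x \<in> quad_ext F e"
  proof (cases "x = 0")
    case True
    thus ?thesis using quad_extI[OF zero zero] by simp
  next
    case False
    define N where "N = A\<^sup>2 - B\<^sup>2 * e\<^sup>2"
    have N: "N \<in> F" "N \<noteq> 0" using norm_neq_0 x False square by (auto simp: N_def intro!: closed)
    have "x * (A / N + (- B / N) * e) = 1"
      using N(2) by (simp add: x(1) field_simps) (simp add: N_def power2_eq_square algebra_simps)
    hence "inverse x = A / N + (- B / N) * e" by (metis inverse_unique)
    also have "\<dots> \<in> quad_ext F e" using x N by (intro quad_extI closed)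
    finally show ?thesis .
  qed
  fix y assume "y \<in> quad_ext F e"
  then obtain C D where y: "y = C + D * e" "C \<in> F" "D \<in> F" by (auto simp: quad_ext_def)
  have "x - y = (A - C) + (B - D) * e" by (simp add: x y algebra_simps)
  also have "\<dots> \<in> quad_ext F e" using x y by (intro quad_extI closed)
  finally show "x - y \<in> quad_ext F e" .
  have "x * y = (A * C + B * D * e\<^sup>2) + (A * D + B * C) * e"
    by (simp add: x y algebra_simps power2_eq_square)
  also have "\<dots> \<in> quad_ext F e" by (intro quad_extI add mult square x y)
  finally show "x * y \<in> quad_ext F e" .
qed

lemma subset_quad_ext: "F \<subseteq> quad_ext F e"
  using quad_extI[OF _ zero] by force

lemma mem_quad_ext: "e \<in> quad_ext F e"
  using quad_extI[OF zero one] by simp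

text \<open>Conjugation over \<open>F\<close> is a ring homomorphism on \<open>F(e)\<close>, so it commutes with evaluating
  integer polynomials.\<close>

lemma algebraic_int_conj:
  assumes "A \<in> F" "B \<in> F" "algebraic_int (A + B * e)"
  shows "algebraic_int (A - B * e)"
proof -
  have *: "\<exists>C\<in>F. \<exists>D\<in>F. poly (map_poly of_int p) (A + B * e) = C + D * e \<and>
      poly (map_poly of_int p) (A - B * e) = C - D * e" for p :: "int poly"
  proof (induction p)
    case 0
    show ?case using zero by (intro bexI[of _ 0]) auto
  next
    case (pCons c p)
    then obtain C D where CD: "C \<in> F" "D \<in> F"
      "poly (map_poly of_int p) (A + B * e) = C + D * e"
      "poly (map_poly of_int p) (A - B * e) = C - D * e" by blast
    show ?case
    proof (intro bexI conjI)
      show "poly (map_poly of_int (pCons c p)) (A + B * e)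
        = (of_int c + A * C + B * D * e\<^sup>2) + (A * D + B * C) * e"
        by (simp add: of_int_hom.map_poly_pCons_hom CD algebra_simps power2_eq_square)
      show "poly (map_poly of_int (pCons c p)) (A - B * e)
        = (of_int c + A * C + B * D * e\<^sup>2) - (A * D + B * C) * e"
        by (simp add: of_int_hom.map_poly_pCons_hom CD algebra_simps power2_eq_square)
    qed (use assms CD square in \<open>auto intro!: closed\<close>)
  qed
  obtain p where p: "poly (map_poly of_int p) (A + B * e) = 0" "lead_coeff p = 1"
    using assms(3) by (auto simp: algebraic_int_altdef_ipoly)
  obtain C D where CD: "C \<in> F" "D \<in> F"
      "poly (map_poly of_int p) (A + B * e) = C + D * e"
      "poly (map_poly of_int p) (A - B * e) = C - D * e" using *[of p] by blast
  hence "C = 0 \<and> D = 0" using p(1) eq_0 by simp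
  hence "poly (map_poly of_int p) (A - B * e) = 0" using CD by simp
  thus ?thesis using p(2) by (auto simp: algebraic_int_altdef_ipoly)
qed

end

section \<open>Indices of additive subgroups of the complex numbers\<close>

locale complex_subgroups =
  fixes R H :: "complex set"
  assumes zero_R: "0 \<in> R" and diff_R: "x \<in> R \<Longrightarrow> y \<in> R \<Longrightarrow> x - y \<in> R"
    and zero_H: "0 \<in> H" and diff_H: "x \<in> H \<Longrightarrow> y \<in> H \<Longrightarrow> x - y \<in> H"
    and subset: "H \<subseteq> R"
begin

abbreviation G where "G \<equiv> add_monoid (complex_ring\<lparr>carrier := R\<rparr>)"

abbreviation cosets where "cosets \<equiv> a_rcosets\<^bsub>complex_ring\<lparr>carrier := R\<rparr>\<^esub> H"

lemma uminus_R: "x \<in> R \<Longrightarrow> - x \<in> R" using diff_R[OF zero_R, of x] by simp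
lemma add_R: "x \<in> R \<Longrightarrow> y \<in> R \<Longrightarrow> x + y \<in> R" using diff_R[of x "-y"] uminus_R by simp
lemma uminus_H: "x \<in> H \<Longrightarrow> - x \<in> H" using diff_H[OF zero_H, of x] by simp
lemma add_H: "x \<in> H \<Longrightarrow> y \<in> H \<Longrightarrow> x + y \<in> H" using diff_H[of x "-y"] uminus_H by simp

lemma comm_group_G: "comm_group G"
  by (rule comm_groupI) (auto simp: zero_R add_R intro!: bexI[of _ "- x" for x] uminus_R)

sublocale comm_group G by (rule comm_group_G)

lemma inv_G: "x \<in> R \<Longrightarrow> inv\<^bsub>G\<^esub> x = - x"
  by (rule comm_inv_char) (auto simp: uminus_R)

lemma subgroup_H: "subgroup H G"
  by (rule subgroupI) (use subset zero_H uminus_H add_H inv_G in auto)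

lemma pow_G: "x [^]\<^bsub>G\<^esub> (n :: nat) = of_nat n * x"
  by (induction n) (auto simp: algebra_simps)

lemma cosets_eq: "cosets = rcosets\<^bsub>G\<^esub> H"
  by (simp add: A_RCOSETS_def)

lemma card_cosets_mult:
  assumes "finite cosets" "x \<in> R"
  shows "of_nat (card cosets) * x \<in> H"
  using pow_index_mem[OF subgroup_H, of x] assms unfolding cosets_eq pow_G by simp

text \<open>Two elements with the same value of \<open>g\<close> lie in one coset, so
  \<open>g\<close> bounds the quotient. Finiteness must be known before any claim of
  non-divisibility: \<open>card\<close> is 0 on an infinite quotient, and everything divides
  0.\<close>

lemma finite_cosets:
  assumes fin: "finite (g ` R)" and g: "\<And>x y. x \<in> R \<Longrightarrow> y \<in> R \<Longrightarrow> g x = g y \<Longrightarrow> x - y \<in> H"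
  shows "finite cosets"
proof -
  define f where "f v = H #>\<^bsub>G\<^esub> (SOME x. x \<in> R \<and> g x = v)" for v
  have "H #>\<^bsub>G\<^esub> x = f (g x)" if x: "x \<in> R" for x
  proof -
    define y where "y = (SOME y. y \<in> R \<and> g y = g x)"
    have y: "y \<in> R \<and> g y = g x" unfolding y_def by (rule someI[of _ x]) (use x in simp)
    have "y = (y - x) \<otimes>\<^bsub>G\<^esub> x" by simp
    moreover have "y - x \<in> H" using g x y by blast
    ultimately have "y \<in> H #>\<^bsub>G\<^esub> x" unfolding r_coset_def by blast
    from repr_independence[OF this _ subgroup_H] x show ?thesis
      by (simp add: f_def flip: y_def)
  qed
  hence "cosets \<subseteq> f ` (g ` R)" unfolding cosets_eq RCOSETS_def by auto
  thus ?thesis using fin finite_surj by blast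
qed

text \<open>If \<open>p ^ a\<close> divided the index, there would be \<open>p ^ a\<close> distinct
  classes killed by \<open>p ^ a\<close>, but each of them is the class of some element of the
  smaller set \<open>C\<close>. With \<open>C = {0}\<close> the condition says that there is no such
  torsion at all.\<close>

lemma not_prime_power_dvd_index:
  assumes p: "Factorial_Ring.prime p" and fin: "finite cosets" "finite C" and card: "card C < p ^ a"
    and C: "\<And>x. x \<in> R \<Longrightarrow> of_nat (p ^ a) * x \<in> H \<Longrightarrow> \<exists>c\<in>C. x - c \<in> H"
  shows "\<not> p ^ a dvd card cosets"
proof
  assume "p ^ a dvd card cosets"
  then obtain T where T: "T \<subseteq> carrier G" "card T = p ^ a"
    "\<And>x. x \<in> T \<Longrightarrow> x [^]\<^bsub>G\<^esub> (p ^ a) \<in> H"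
    "\<And>x y. x \<in> T \<Longrightarrow> y \<in> T \<Longrightarrow> x \<otimes>\<^bsub>G\<^esub> inv\<^bsub>G\<^esub> y \<in> H \<Longrightarrow> x = y"
    using ex_torsion_transversal[OF subgroup_H _ p, of a] fin by (metis cosets_eq)
  have "\<exists>c\<in>C. x - c \<in> H" if "x \<in> T" for x
    using C[of x] T(1) T(3)[OF that] that unfolding pow_G by auto
  then obtain f where f: "\<And>x. x \<in> T \<Longrightarrow> f x \<in> C" "\<And>x. x \<in> T \<Longrightarrow> x - f x \<in> H" by metis
  have "inj_on f T"
  proof (rule inj_onI)
    fix x y assume xy: "x \<in> T" "y \<in> T" "f x = f y"
    have "(x - f x) - (y - f y) \<in> H" by (intro diff_H f xy)
    hence "x - y \<in> H" using xy by simp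
    moreover have "y \<in> R" using T(1) xy by auto
    moreover have "x \<otimes>\<^bsub>G\<^esub> inv\<^bsub>G\<^esub> y = x - y"
      by (subst inv_G) (use \<open>y \<in> R\<close> in simp_all)
    ultimately show "x = y" using T(4)[OF xy(1,2)] by metis
  qed
  hence "card T \<le> card C" using f(1) fin(2) by (intro card_inj_on_le[of f]) auto
  thus False using T card by simp
qed

end

lemma algebraic_int_sqrt_intro: "algebraic_int (x\<^sup>2) \<Longrightarrow> algebraic_int (x :: 'a :: field_char_0)"
  by (erule algebraic_int_root[of _ "Polynomial.monom 1 2"])
     (auto simp: poly_monom degree_monom_eq)

lemma ring_of_integers_diff:
  "sub_field K \<Longrightarrow> x \<in> ring_of_integers K \<Longrightarrow> y \<in> ring_of_integers K \<Longrightarrow> x - y \<in> ring_of_integers K"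
  by (auto simp: ring_of_integers_def sub_field.diff algebraic_int_diff)

lemma int_adjoin_subset:
  assumes "sub_field K" "\<theta> \<in> ring_of_integers K"
  shows "int_adjoin \<theta> \<subseteq> ring_of_integers K"
proof
  interpret sub_field K by fact
  fix x assume "x \<in> int_adjoin \<theta>"
  thus "x \<in> ring_of_integers K"
    by (induction rule: int_adjoin_induct)
       (use assms in \<open>auto simp: ring_of_integers_def intro: closed algebraic_int_plus algebraic_int_times\<close>)
qed

lemma complex_subgroups_int_adjoin:
  assumes "sub_field K" "\<theta> \<in> ring_of_integers K"
  shows "complex_subgroups (ring_of_integers K) (int_adjoin \<theta>)"
  using assms int_adjoin_subset[OF assms] ring_of_integers_diff[OF assms(1)]
  by unfold_locales
     (auto intro: int_adjoin_0 int_adjoin_diff simp: ring_of_integers_def sub_field.zero)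

section \<open>Orders in towers of two quadratic extensions\<close>

text \<open>The two non-membership conditions make 1, \<epsilon>, \<eta>, \<epsilon>\<eta> a basis
  of K over the rationals.\<close>

locale quartic_tower =
  fixes \<epsilon> \<eta> :: complex and m s t :: int
  assumes eps_sq: "\<epsilon>\<^sup>2 = of_int m" and eta_sq: "\<eta>\<^sup>2 = of_int s + of_int t * \<epsilon>"
    and eps_notin: "\<epsilon> \<notin> \<rat>" and eta_notin: "\<eta> \<notin> quad_ext \<rat> \<epsilon>"
begin

sublocale k: quadratic_ext "\<rat> :: complex set" \<epsilon>
proof -
  interpret sub_field "\<rat> :: complex set" by (rule sub_field_Rats)
  show "quadratic_ext \<rat> \<epsilon>" by unfold_locales (simp_all add: eps_sq eps_notin)
qed

sublocale L: quadratic_ext "quad_ext \<rat> \<epsilon>" \<eta>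
proof -
  interpret q: sub_field "quad_ext \<rat> \<epsilon>" by (rule k.sub_field_quad_ext)
  show "quadratic_ext (quad_ext \<rat> \<epsilon>) \<eta>"
    by unfold_locales (simp_all add: eta_sq eta_notin quad_extI)
qed

definition K :: "complex set" where "K = quad_ext (quad_ext \<rat> \<epsilon>) \<eta>"

abbreviation R :: "complex set" where "R \<equiv> ring_of_integers K"

definition el :: "int \<Rightarrow> int \<Rightarrow> int \<Rightarrow> int \<Rightarrow> complex"
  where "el p q r u = (of_int p + of_int q * \<epsilon>) + (of_int r + of_int u * \<epsilon>) * \<eta>"

definition Ord :: "complex set"
  where "Ord = {el p q r u | p q r u. True}"

lemma el_in_Ord [simp, intro]: "el p q r u \<in> Ord" by (auto simp: Ord_def)

lemma el_diff: "el p q r u - el p' q' r' u' = el (p - p') (q - q') (r - r') (u - u')"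
  and el_add: "el p q r u + el p' q' r' u' = el (p + p') (q + q') (r + r') (u + u')"
  and el_scale: "of_int n * el p q r u = el (n * p) (n * q) (n * r) (n * u)"
  and el_uminus: "- el p q r u = el (- p) (- q) (- r) (- u)"
  by (simp_all add: el_def algebra_simps)

lemma eps_eps: "\<epsilon> * \<epsilon> = of_int m" "\<epsilon> * (\<epsilon> * x) = of_int m * x"
  using eps_sq by (simp_all add: power2_eq_square flip: mult.assoc)

lemma eta_eta: "\<eta> * \<eta> = of_int s + of_int t * \<epsilon>" "\<eta> * (\<eta> * x) = (of_int s + of_int t * \<epsilon>) * x"
  using eta_sq by (simp_all add: power2_eq_square flip: mult.assoc)

text \<open>\<open>P + Q * \<epsilon>\<close> is the product of the two coefficients of \<eta>;
  multiplied by \<open>\<eta>\<^sup>2\<close> it contributes the terms with \<open>s\<close> and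
  \<open>t\<close>.\<close>

lemma el_mult: "el p q r u * el p' q' r' u' =
   (let P = r * r' + m * u * u'; Q = r * u' + u * r' in
    el (p * p' + m * q * q' + P * s + Q * t * m) (p * q' + q * p' + P * t + Q * s)
       (p * r' + m * q * u' + r * p' + m * u * q') (p * u' + q * r' + r * q' + u * p'))"
  by (simp add: el_def Let_def algebra_simps eps_eps eta_eta)

lemma el_0: "el p q r u = 0 \<Longrightarrow> p = 0 \<and> q = 0 \<and> r = 0 \<and> u = 0"
proof -
  assume "el p q r u = 0"
  hence "(of_int p + of_int q * \<epsilon>) = 0 \<and> (of_int r + of_int u * \<epsilon>) = 0"
    unfolding el_def by (intro L.eq_0 quad_extI) auto
  thus ?thesis using k.eq_0[of "of_int p" "of_int q"] k.eq_0[of "of_int r" "of_int u"] by auto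
qed

lemma el_inject: "el p q r u = el p' q' r' u' \<longleftrightarrow> p = p' \<and> q = q' \<and> r = r' \<and> u = u'"
  using el_0[of "p - p'" "q - q'" "r - r'" "u - u'"] by (auto simp flip: el_diff)

lemma el_eta: "\<eta> = el 0 0 1 0"
  by (simp add: el_def)

lemma sub_field_K: "sub_field K"
  unfolding K_def by (rule L.sub_field_quad_ext)

lemma eps_K: "\<epsilon> \<in> K" and eta_K: "\<eta> \<in> K"
  using k.mem_quad_ext L.mem_quad_ext L.subset_quad_ext by (auto simp: K_def)

lemma algebraic_int_eps: "algebraic_int \<epsilon>"
  by (rule algebraic_int_sqrt_intro) (simp add: eps_sq)

lemma algebraic_int_eta: "algebraic_int \<eta>"
  by (rule algebraic_int_sqrt_intro)
     (auto simp: eta_sq intro!: algebraic_int_plus algebraic_int_times algebraic_int_eps)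

lemma Ord_subset: "Ord \<subseteq> R"
proof
  interpret K: sub_field K by (rule sub_field_K)
  fix x assume "x \<in> Ord"
  then obtain p q r u where "x = el p q r u" by (auto simp: Ord_def)
  thus "x \<in> R" unfolding el_def ring_of_integers_def
    by (auto intro!: K.closed algebraic_int_plus algebraic_int_times algebraic_int_eps
        algebraic_int_eta eps_K eta_K)
qed

lemma m_nonzero: "m \<noteq> 0"
  using eps_sq eps_notin by auto

text \<open>The norm of \<open>\<eta>\<^sup>2\<close> from Q(\<epsilon>) down to Q.\<close>

definition N :: int where "N = s\<^sup>2 - m * t\<^sup>2"

lemma N_eq: "(of_int s + of_int t * \<epsilon>) * (of_int s - of_int t * \<epsilon>) = of_int N"
  using eps_sq by (simp add: N_def algebra_simps power2_eq_square)

lemma N_nonzero: "N \<noteq> 0"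
proof
  assume "N = 0"
  hence "of_int s + of_int t * \<epsilon> = 0"
    using k.norm_neq_0[of "of_int s" "of_int t"] by (auto simp: N_def eps_sq mult.commute simp flip: of_int_power of_int_mult)
  hence "\<eta> = 0" using eta_sq by simp
  thus False using eta_notin L.zero by simp
qed

text \<open>Trace and norm are algebraic integers, because the conjugate is one, and they are
  rational.\<close>

lemma k_integers:
  assumes "a \<in> \<rat>" "b \<in> \<rat>" "algebraic_int (a + b * \<epsilon>)"
  shows "2 * a \<in> \<int>" "a\<^sup>2 - of_int m * b\<^sup>2 \<in> \<int>"
proof -
  have conj: "algebraic_int (a - b * \<epsilon>)" by (rule k.algebraic_int_conj[OF assms])
  have "(a + b * \<epsilon>) + (a - b * \<epsilon>) = 2 * a" by simp
  hence "algebraic_int (2 * a)" using algebraic_int_plus[OF assms(3) conj] by simp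
  thus "2 * a \<in> \<int>" using assms by (intro rational_algebraic_int_is_int) auto
  have "(a + b * \<epsilon>) * (a - b * \<epsilon>) = a\<^sup>2 - of_int m * b\<^sup>2"
    using eps_sq by (simp add: algebra_simps power2_eq_square)
  hence "algebraic_int (a\<^sup>2 - of_int m * b\<^sup>2)" using algebraic_int_times[OF assms(3) conj] by simp
  thus "a\<^sup>2 - of_int m * b\<^sup>2 \<in> \<int>" using assms by (intro rational_algebraic_int_is_int) auto
qed

text \<open>The square of \<open>2 * m * b\<close> is \<open>m\<close> times (trace squared minus
  four times the norm), an integer; a rational square root of an integer is an integer.\<close>

lemma k_bound:
  assumes "a \<in> \<rat>" "b \<in> \<rat>" "algebraic_int (a + b * \<epsilon>)"
  obtains p q where "of_int (2 * m) * (a + b * \<epsilon>) = of_int p + of_int q * \<epsilon>"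
proof -
  obtain p where p: "2 * a = of_int p" using k_integers(1)[OF assms] by (auto elim: Ints_cases)
  obtain n where n: "a\<^sup>2 - of_int m * b\<^sup>2 = of_int n" using k_integers(2)[OF assms] by (auto elim: Ints_cases)
  have "(of_int (2 * m) * b)\<^sup>2 = of_int m * ((2 * a)\<^sup>2 - 4 * (a\<^sup>2 - of_int m * b\<^sup>2))"
    by (simp add: algebra_simps power2_eq_square)
  also have "\<dots> = of_int (m * (p\<^sup>2 - 4 * n))" unfolding p n by simp
  finally have "algebraic_int ((of_int (2 * m) * b)\<^sup>2)" by (simp only: algebraic_int_of_int)
  from algebraic_int_sqrt_intro[OF this] have "of_int (2 * m) * b \<in> \<int>"
    using assms by (intro rational_algebraic_int_is_int) auto
  then obtain q where q: "of_int (2 * m) * b = of_int q" by (auto elim: Ints_cases)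
  have "of_int (2 * m) * (a + b * \<epsilon>) = of_int m * (2 * a) + of_int (2 * m) * b * \<epsilon>"
    by (simp add: algebra_simps)
  also have "\<dots> = of_int (m * p) + of_int q * \<epsilon>" unfolding p q by simp
  finally show ?thesis by (rule that)
qed

definition D :: int where "D = 4 * m * N"

lemma D_nonzero: "D \<noteq> 0" by (simp add: D_def m_nonzero N_nonzero)

lemma integers_conj:
  assumes "A \<in> quad_ext \<rat> \<epsilon>" "B \<in> quad_ext \<rat> \<epsilon>" "algebraic_int (A + B * \<eta>)"
  shows "algebraic_int (2 * A)" "algebraic_int (2 * B * \<eta>)"
proof -
  have conj: "algebraic_int (A - B * \<eta>)" by (rule L.algebraic_int_conj[OF assms])
  show "algebraic_int (2 * A)" using algebraic_int_plus[OF assms(3) conj] by simp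
  show "algebraic_int (2 * B * \<eta>)" using algebraic_int_diff[OF assms(3) conj] by (simp add: mult.assoc)
qed

text \<open>The coefficient \<open>B\<close> is freed of \<eta> by multiplying the integer
  \<open>2 * B * \<eta>\<close> with \<eta> and with the conjugate of \<open>\<eta>\<^sup>2\<close>:
  the result \<open>2 * N * B\<close> is an integer of Q(\<epsilon>). Denominators there divide
  \<open>2 * m\<close>, whence \<open>D = 4 * m * N\<close>.\<close>

lemma D_mult_in_Ord:
  assumes "x \<in> R"
  shows "of_int D * x \<in> Ord"
proof -
  obtain A B where x: "x = A + B * \<eta>" "A \<in> quad_ext \<rat> \<epsilon>" "B \<in> quad_ext \<rat> \<epsilon>"
    and "algebraic_int (A + B * \<eta>)"
    using assms unfolding ring_of_integers_def K_def by (auto simp: quad_ext_def[of "quad_ext \<rat> \<epsilon>"])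
  note AB = integers_conj[OF x(2,3) this(4)]
  have k_mem: "\<exists>p q. of_int (2 * m) * y = of_int p + of_int q * \<epsilon>"
    if y: "y \<in> quad_ext \<rat> \<epsilon>" "algebraic_int y" for y
  proof -
    obtain a b where "y = a + b * \<epsilon>" "a \<in> \<rat>" "b \<in> \<rat>" using y(1) by (auto simp: quad_ext_def)
    thus ?thesis using k_bound[of a b] y(2) by metis
  qed
  have mem: "2 * A \<in> quad_ext \<rat> \<epsilon>" "2 * of_int N * B \<in> quad_ext \<rat> \<epsilon>"
    using x by (auto intro!: L.closed)
  have "(2 * B * \<eta>) * \<eta> * (of_int s - of_int t * \<epsilon>) = 2 * B * (\<eta>\<^sup>2 * (of_int s - of_int t * \<epsilon>))"
    by (simp add: power2_eq_square)
  also have "\<dots> = 2 * of_int N * B" unfolding eta_sq N_eq by simp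
  finally have "(2 * B * \<eta>) * \<eta> * (of_int s - of_int t * \<epsilon>) = 2 * of_int N * B" .
  moreover have "algebraic_int ((2 * B * \<eta>) * \<eta> * (of_int s - of_int t * \<epsilon>))"
    by (intro algebraic_int_times[OF algebraic_int_times[OF AB(2) algebraic_int_eta]]
        algebraic_int_diff algebraic_int_times algebraic_int_eps algebraic_int_of_int)
  ultimately have "algebraic_int (2 * of_int N * B)" by metis
  then obtain p q where pq: "of_int (2 * m) * (2 * of_int N * B) = of_int p + of_int q * \<epsilon>"
    using k_mem mem by blast
  obtain p' q' where pq': "of_int (2 * m) * (2 * A) = of_int p' + of_int q' * \<epsilon>"
    using k_mem mem AB by blast
  have "of_int D * x = of_int N * (of_int (2 * m) * (2 * A)) + of_int (2 * m) * (2 * of_int N * B) * \<eta>"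
    by (simp add: x D_def algebra_simps)
  also have "\<dots> = el (N * p') (N * q') p q" unfolding pq pq' by (simp add: el_def algebra_simps)
  finally show ?thesis by simp
qed

lemma rat_adjoin_eq_K:
  assumes "\<theta> \<in> K" "d \<noteq> 0" "of_int d * \<epsilon> \<in> int_adjoin \<theta>" "of_int d * \<eta> \<in> int_adjoin \<theta>"
  shows "rat_adjoin \<theta> = K"
proof
  show "rat_adjoin \<theta> \<subseteq> K" by (rule rat_adjoin_subset[OF sub_field_K assms(1)])
  interpret F: sub_field "rat_adjoin \<theta>" by (rule sub_field_rat_adjoin)
  have sub: "x \<in> rat_adjoin \<theta>" if "x \<in> int_adjoin \<theta>" for x
    using that by (induction rule: int_adjoin_induct) (auto intro: F.closed mem_rat_adjoin)
  have "\<epsilon> \<in> rat_adjoin \<theta>" "\<eta> \<in> rat_adjoin \<theta>"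
    using F.divide[OF sub[OF assms(3)] F.of_int, of d] F.divide[OF sub[OF assms(4)] F.of_int, of d]
      assms(2) by simp_all
  thus "K \<subseteq> rat_adjoin \<theta>"
    unfolding K_def quad_ext_def using F.Rats by (auto intro!: F.add F.mult)
qed

text \<open>Every integer x of K is determined modulo \<open>d\<close> times the order, hence modulo
  Z[\<theta>], by the coordinates of \<open>D * x\<close> modulo \<open>D * d\<close>.\<close>

lemma finite_index:
  assumes \<theta>: "\<theta> \<in> R" and d: "d \<noteq> 0"
    "\<And>x. x \<in> Ord \<Longrightarrow> of_int d * x \<in> int_adjoin \<theta>"
  shows "finite (a_rcosets\<^bsub>complex_ring\<lparr>carrier := R\<rparr>\<^esub> (int_adjoin \<theta>))"
proof -
  interpret complex_subgroups R "int_adjoin \<theta>"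
    by (rule complex_subgroups_int_adjoin[OF sub_field_K \<theta>])
  have "\<exists>p q r u. of_int D * x = el p q r u" if "x \<in> R" for x
    using D_mult_in_Ord[OF that] by (auto simp: Ord_def)
  then obtain p q r u where el: "\<And>x. x \<in> R \<Longrightarrow> of_int D * x = el (p x) (q x) (r x) (u x)"
    by metis
  define n where "n = \<bar>D * d\<bar>"
  have n: "n > 0" using d D_nonzero by (simp add: n_def)
  define g where "g x = (p x mod n, q x mod n, r x mod n, u x mod n)" for x
  show ?thesis
  proof (rule finite_cosets[of g])
    have "g ` R \<subseteq> {0..<n} \<times> {0..<n} \<times> {0..<n} \<times> {0..<n}" using n by (auto simp: g_def)
    thus "finite (g ` R)" by (rule finite_subset) auto
  next
    fix x y assume xy: "x \<in> R" "y \<in> R" "g x = g y"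
    have dvd: "D * d dvd p x - p y" "D * d dvd q x - q y" "D * d dvd r x - r y" "D * d dvd u x - u y"
      using xy(3) by (auto simp: g_def n_def mod_eq_dvd_iff)
    then obtain p' q' r' u' where *: "p x - p y = D * d * p'" "q x - q y = D * d * q'"
      "r x - r y = D * d * r'" "u x - u y = D * d * u'" by (auto simp: dvd_def)
    have "of_int D * (x - y) = el (p x - p y) (q x - q y) (r x - r y) (u x - u y)"
      using el xy by (simp add: algebra_simps flip: el_diff)
    also have "\<dots> = of_int D * (of_int d * el p' q' r' u')" unfolding * by (simp add: el_scale mult_ac)
    finally have "x - y = of_int d * el p' q' r' u'" using D_nonzero by simp
    thus "x - y \<in> int_adjoin \<theta>" using d(2) by simp
  qed
qed

end

section \<open>Maximality at 3 of the order Z[\<epsilon>, \<eta>]\<close>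

lemma not_3_dvd_imp_coprime: "\<not> 3 dvd (k :: int) \<Longrightarrow> Rings.coprime 3 k"
  using prime_imp_coprime[of "3::int" k] by simp

lemma prime_dvd_mult_3: "3 dvd (a * b :: int) \<longleftrightarrow> 3 dvd a \<or> 3 dvd b"
  by (rule prime_dvd_mult_iff) simp

lemma dvd_9_cancel: "9 dvd (a * b :: int) \<Longrightarrow> \<not> 3 dvd a \<Longrightarrow> 9 dvd b"
  using coprime_dvd_mult_right_iff[of "9::int" a b]
    coprime_power_left_iff[of "3::int" 2 a] not_3_dvd_imp_coprime[of a] by simp

text \<open>This predicate says that \<open>(r + u \<epsilon>)\<^sup>2 \<eta>\<^sup>2\<close> is divisible by \<open>9\<close> in \<open>\<int>[\<epsilon>]\<close> only if \<open>r + u \<epsilon>\<close>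
  is divisible by \<open>3\<close>, where \<open>\<epsilon>\<^sup>2 = m\<close> and \<open>\<eta>\<^sup>2 = s + t \<epsilon>\<close>.\<close>

definition sqfree_at_3 :: "int \<Rightarrow> int \<Rightarrow> int \<Rightarrow> bool"
  where "sqfree_at_3 m s t \<longleftrightarrow> (\<forall>r u. 9 dvd (r\<^sup>2 + m * u\<^sup>2) * s + 2 * r * u * t * m \<longrightarrow>
    9 dvd (r\<^sup>2 + m * u\<^sup>2) * t + 2 * r * u * s \<longrightarrow> 3 dvd r \<and> 3 dvd u)"

locale quartic_tower_3 = quartic_tower +
  assumes m9: "\<not> 9 dvd m" and sqfree: "sqfree_at_3 m s t"
begin

lemma OrdE:
  assumes "x \<in> Ord"
  obtains p q r u where "x = el p q r u"
  using assms by (auto simp: Ord_def)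

text \<open>The trace 2p/3 forces 3 to divide p; then integrality of the norm gives 9 | m q^2, and 9
  does not divide m.\<close>

lemma k_maximal:
  assumes "algebraic_int ((of_int p + of_int q * \<epsilon>) / 3)"
  shows "3 dvd p \<and> 3 dvd q"
proof -
  have *: "algebraic_int (of_int p / 3 + of_int q / 3 * \<epsilon>)" using assms by (simp add: add_divide_distrib)
  have "2 * (of_int p / 3 :: complex) \<in> \<int>" by (rule k_integers(1)[OF _ _ *]) auto
  then obtain i where "2 * (of_int p / 3 :: complex) = of_int i" by (auto elim: Ints_cases)
  hence "(of_int (2 * p) :: complex) = of_int (3 * i)" by (simp add: field_simps)
  hence "2 * p = 3 * i" by (simp only: of_int_eq_iff)
  hence p: "3 dvd p" by presburger
  have "(of_int p / 3 :: complex)\<^sup>2 - of_int m * (of_int q / 3)\<^sup>2 \<in> \<int>"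
    by (rule k_integers(2)[OF _ _ *]) auto
  then obtain j where "(of_int p / 3 :: complex)\<^sup>2 - of_int m * (of_int q / 3)\<^sup>2 = of_int j"
    by (auto elim: Ints_cases)
  hence "(of_int (p\<^sup>2 - m * q\<^sup>2) :: complex) = of_int (9 * j)" by (simp add: field_simps power2_eq_square)
  hence "p\<^sup>2 - m * q\<^sup>2 = 9 * j" by (simp only: of_int_eq_iff)
  moreover obtain p' where "p = 3 * p'" using p by auto
  ultimately have "9 * (p'\<^sup>2 - j) = q * (q * m)" by (simp add: power2_eq_square algebra_simps)
  hence "9 dvd q * (q * m)" by (metis dvd_triv_left)
  hence "3 dvd q" using dvd_9_cancel[of q "q * m"] dvd_9_cancel[of q m] m9 by blast
  thus ?thesis using p by simp
qed

lemma k_maximal_9: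
  assumes "algebraic_int ((of_int p + of_int q * \<epsilon>) / 9)"
  shows "9 dvd p \<and> 9 dvd q"
proof -
  have "3 * ((of_int p + of_int q * \<epsilon>) / 9) = (of_int p + of_int q * \<epsilon>) / 3" by simp
  hence "algebraic_int ((of_int p + of_int q * \<epsilon>) / 3)"
    by (metis algebraic_int_numeral algebraic_int_times assms)
  from k_maximal[OF this] obtain p' q' where pq: "p = 3 * p'" "q = 3 * q'" by (auto elim!: dvdE)
  have "(of_int p + of_int q * \<epsilon>) / 9 = (of_int p' + of_int q' * \<epsilon>) / 3"
    by (simp add: pq field_simps)
  from k_maximal[OF assms[unfolded this]] pq show ?thesis by auto
qed

text \<open>The part \<open>2 * A\<close> is handled in Q(\<epsilon>). The other part
  \<open>2 * B * \<eta>\<close> is not in Q(\<epsilon>), but its square is: integrality of that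
  square makes 9 divide both coordinates of (r + u \<epsilon>)^2 \<open>\<eta>\<^sup>2\<close>,
  which is what \<open>sqfree_at_3\<close> is made for.\<close>

lemma maximal:
  assumes x: "x \<in> R" and "3 * x \<in> Ord"
  shows "x \<in> Ord"
proof -
  obtain p q r u where el: "3 * x = el p q r u" using assms by (auto simp: Ord_def)
  define A B where "A = of_int p / 3 + of_int q / 3 * \<epsilon>" and "B = of_int r / 3 + of_int u / 3 * \<epsilon>"
  have AB: "A \<in> quad_ext \<rat> \<epsilon>" "B \<in> quad_ext \<rat> \<epsilon>" unfolding A_def B_def by (intro quad_extI; simp)+
  have x_eq: "x = A + B * \<eta>"
    using el by (simp add: el_def A_def B_def field_simps)
  have "algebraic_int (A + B * \<eta>)" using x unfolding x_eq ring_of_integers_def by simp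
  note conj = integers_conj[OF AB this]
  have "2 * A = (of_int (2 * p) + of_int (2 * q) * \<epsilon>) / 3" by (simp add: A_def field_simps)
  from k_maximal[OF conj(1)[unfolded this]] have pq: "3 dvd p" "3 dvd q" by presburger+
  define P Q where "P = (r\<^sup>2 + m * u\<^sup>2) * s + 2 * r * u * t * m" and "Q = (r\<^sup>2 + m * u\<^sup>2) * t + 2 * r * u * s"
  have "(of_int r + of_int u * \<epsilon>)\<^sup>2 = of_int (r\<^sup>2 + m * u\<^sup>2) + of_int (2 * r * u) * \<epsilon>"
    using eps_eps by (simp add: algebra_simps power2_eq_square)
  hence PQ: "(of_int r + of_int u * \<epsilon>)\<^sup>2 * \<eta>\<^sup>2 = of_int P + of_int Q * \<epsilon>"
    unfolding eta_sq P_def Q_def by (simp add: algebra_simps eps_eps)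
  have "(2 * B * \<eta>) * (2 * B * \<eta>) = 4 * ((of_int r + of_int u * \<epsilon>)\<^sup>2 * \<eta>\<^sup>2) / 9"
    by (simp add: B_def field_simps power2_eq_square)
  also have "\<dots> = (of_int (4 * P) + of_int (4 * Q) * \<epsilon>) / 9" unfolding PQ by (simp add: field_simps)
  finally have "algebraic_int ((of_int (4 * P) + of_int (4 * Q) * \<epsilon>) / 9)"
    using algebraic_int_times[OF conj(2) conj(2)] by metis
  from k_maximal_9[OF this] have "9 dvd P" "9 dvd Q" by presburger+
  hence ru: "3 dvd r" "3 dvd u" using sqfree unfolding sqfree_at_3_def P_def Q_def by blast+
  from pq ru obtain p' q' r' u' where *: "p = 3 * p'" "q = 3 * q'" "r = 3 * r'" "u = 3 * u'"
    by (auto simp: dvd_def)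
  have "3 * x = 3 * el p' q' r' u'" unfolding el * using el_scale[of 3] by simp
  thus ?thesis by simp
qed

lemma maximal_power: "x \<in> R \<Longrightarrow> 3 ^ n * x \<in> Ord \<Longrightarrow> x \<in> Ord"
proof (induction n)
  case (Suc n)
  have R: "of_int k * x \<in> R" for k
  proof -
    interpret K: sub_field K by (rule sub_field_K)
    show ?thesis using Suc.prems(1) by (auto simp: ring_of_integers_def intro: K.closed algebraic_int_times)
  qed
  have "3 ^ n * x \<in> R" using R[of "3 ^ n"] by simp
  hence "3 ^ n * x \<in> Ord" by (rule maximal) (use Suc.prems in \<open>simp add: mult.assoc\<close>)
  thus ?case using Suc by simp
qed simp

lemma prime_to_3_mult_in_Ord:
  obtains n :: int where "\<not> 3 dvd n" "\<And>x. x \<in> R \<Longrightarrow> of_int n * x \<in> Ord"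
proof -
  obtain n where n: "\<not> 3 dvd n" "D = 3 ^ multiplicity 3 D * n"
    using multiplicity_decompose'[of D "3::int"] D_nonzero by (auto simp: mult.commute)
  show ?thesis
  proof (rule that[OF n(1)])
    fix x assume x: "x \<in> R"
    interpret K: sub_field K by (rule sub_field_K)
    have "of_int n * x \<in> R" using x by (auto simp: ring_of_integers_def intro: K.closed algebraic_int_times)
    moreover have "3 ^ multiplicity 3 D * (of_int n * x) = of_int D * x"
      by (subst (2) n(2)) simp
    ultimately show "of_int n * x \<in> Ord" using maximal_power D_mult_in_Ord[OF x] by metis
  qed
qed

lemma Ord_mult_int_adjoin:
  assumes "of_int d * \<epsilon> \<in> int_adjoin \<theta>" "of_int d * \<eta> \<in> int_adjoin \<theta>"
    "of_int d * (\<epsilon> * \<eta>) \<in> int_adjoin \<theta>" "x \<in> Ord"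
  shows "of_int d * x \<in> int_adjoin \<theta>"
proof -
  obtain p q r u where x: "x = el p q r u" using assms by (auto simp: Ord_def)
  have "of_int d * x = of_int (d * p) + of_int q * (of_int d * \<epsilon>) + of_int r * (of_int d * \<eta>)
      + of_int u * (of_int d * (\<epsilon> * \<eta>))"
    by (simp add: x el_def algebra_simps)
  also have "\<dots> \<in> int_adjoin \<theta>"
    by (intro int_adjoin_add int_adjoin_mult[OF int_adjoin_of_int] int_adjoin_of_int assms)
  finally show ?thesis .
qed

lemma int_adjoin_subset_Ord:
  assumes "\<theta> \<in> Ord"
  shows "int_adjoin \<theta> \<subseteq> Ord"
proof
  fix x assume "x \<in> int_adjoin \<theta>"
  thus "x \<in> Ord"
  proof (induction rule: int_adjoin_induct)
    case one
    show ?case using el_in_Ord[of 1 0 0 0] by (simp add: el_def)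
  qed (use assms in \<open>auto elim!: OrdE simp: el_uminus el_add el_mult Let_def\<close>)
qed

lemma int_adjoin_cancel:
  assumes "of_int a * x \<in> int_adjoin \<theta>" "of_int b * x \<in> int_adjoin \<theta>"
  shows "of_int (gcd a b) * x \<in> int_adjoin \<theta>"
proof -
  obtain v w where "v * a + w * b = gcd a b" using bezout_int by blast
  hence "of_int (gcd a b) * x = of_int v * (of_int a * x) + of_int w * (of_int b * x)"
    by (metis (no_types, opaque_lifting) distrib_right mult.assoc of_int_add of_int_mult)
  also have "\<dots> \<in> int_adjoin \<theta>"
    by (intro int_adjoin_add int_adjoin_mult[OF int_adjoin_of_int] assms)
  finally show ?thesis .
qed

text \<open>There is no 3-torsion modulo Z[\<theta>]: if 3x lies in Z[\<theta>], then x lies in the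
  order by maximality, so dx lies in Z[\<theta>] too, and d is prime to 3.\<close>

lemma index_not_dvd_3:
  assumes \<theta>: "\<theta> \<in> Ord" and d: "\<not> 3 dvd d"
    and gen: "of_int d * \<epsilon> \<in> int_adjoin \<theta>" "of_int d * \<eta> \<in> int_adjoin \<theta>"
      "of_int d * (\<epsilon> * \<eta>) \<in> int_adjoin \<theta>"
  shows "rat_adjoin \<theta> = K" "\<not> 3 dvd index_of K \<theta>"
proof -
  have \<theta>R: "\<theta> \<in> R" using \<theta> Ord_subset by blast
  have d0: "d \<noteq> 0" using d by auto
  show "rat_adjoin \<theta> = K"
    using rat_adjoin_eq_K[OF _ d0 gen(1,2)] \<theta>R by (simp add: ring_of_integers_def)
  interpret complex_subgroups R "int_adjoin \<theta>"
    by (rule complex_subgroups_int_adjoin[OF sub_field_K \<theta>R])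
  have "\<not> 3 ^ 1 dvd card cosets"
  proof (rule not_prime_power_dvd_index[where C = "{0}"])
    show "finite cosets" by (rule finite_index[OF \<theta>R d0 Ord_mult_int_adjoin[OF gen]])
    fix x assume x: "x \<in> R" "of_nat (3 ^ 1) * x \<in> int_adjoin \<theta>"
    hence 3: "3 * x \<in> int_adjoin \<theta>" by simp
    hence "x \<in> Ord" using maximal[OF x(1)] int_adjoin_subset_Ord[OF \<theta>] by blast
    from Ord_mult_int_adjoin[OF gen this] have "of_int (gcd d 3) * x \<in> int_adjoin \<theta>"
      using 3 by (intro int_adjoin_cancel) auto
    moreover have "gcd d 3 = 1" using not_3_dvd_imp_coprime[OF d] by (simp add: coprime_iff_gcd_eq_1 gcd.commute)
    ultimately show "\<exists>c\<in>{0}. x - c \<in> int_adjoin \<theta>" by simp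
  qed auto
  thus "\<not> 3 dvd index_of K \<theta>" by (simp add: index_of_def)
qed

end

section \<open>Indices of Z[\<theta>] for explicit generators \<theta>\<close>

lemma int_adjoin_quartic:
  assumes \<theta>: "\<theta> ^ 4 = of_int d0 + of_int d1 * \<theta> + of_int d2 * \<theta>\<^sup>2 + of_int d3 * \<theta> ^ 3"
    and "x \<in> int_adjoin \<theta>"
  obtains c0 c1 c2 c3 where "x = of_int c0 + of_int c1 * \<theta> + of_int c2 * \<theta>\<^sup>2 + of_int c3 * \<theta> ^ 3"
proof -
  define f where "f c0 c1 c2 c3 = of_int c0 + of_int c1 * \<theta> + of_int c2 * \<theta>\<^sup>2 + of_int c3 * \<theta> ^ 3" for c0 c1 c2 c3
  define S where "S = {f c0 c1 c2 c3 | c0 c1 c2 c3. True}"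
  have fS: "f c0 c1 c2 c3 \<in> S" for c0 c1 c2 c3 by (auto simp: S_def)
  have add: "x + y \<in> S" if xy: "x \<in> S" "y \<in> S" for x y
  proof -
    obtain a0 a1 a2 a3 b0 b1 b2 b3 where "x = f a0 a1 a2 a3" "y = f b0 b1 b2 b3"
      using xy by (auto simp: S_def)
    hence "x + y = f (a0 + b0) (a1 + b1) (a2 + b2) (a3 + b3)" by (simp add: f_def algebra_simps)
    thus ?thesis using fS by simp
  qed
  have scale: "of_int k * x \<in> S" if x: "x \<in> S" for x k
  proof -
    obtain a0 a1 a2 a3 where "x = f a0 a1 a2 a3" using x by (auto simp: S_def)
    hence "of_int k * x = f (k * a0) (k * a1) (k * a2) (k * a3)" by (simp add: f_def algebra_simps)
    thus ?thesis using fS by simp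
  qed
  have shift: "\<theta> * x \<in> S" if x: "x \<in> S" for x
  proof -
    obtain a0 a1 a2 a3 where "x = f a0 a1 a2 a3" using x by (auto simp: S_def)
    hence "\<theta> * x = f 0 a0 a1 a2 + of_int a3 * \<theta> ^ 4"
      by (simp add: f_def algebra_simps power2_eq_square power3_eq_cube power4_eq_xxxx)
    also have "\<theta> ^ 4 = f d0 d1 d2 d3" by (simp add: f_def \<theta>)
    finally show ?thesis using add scale fS by metis
  qed
  \<comment> \<open>A product is built from repeated multiplication by \<theta>, so the quartic
    relation enters through \<open>shift\<close> alone.\<close>
  have mult: "x * y \<in> S" if xy: "x \<in> S" "y \<in> S" for x y
  proof -
    obtain a0 a1 a2 a3 where x: "x = f a0 a1 a2 a3" using xy by (auto simp: S_def)
    have "x * y = of_int a0 * y + of_int a1 * (\<theta> * y) + of_int a2 * (\<theta> * (\<theta> * y))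
        + of_int a3 * (\<theta> * (\<theta> * (\<theta> * y)))"
      by (simp add: x f_def algebra_simps power2_eq_square power3_eq_cube)
    also have "\<dots> \<in> S" by (intro add scale shift xy(2))
    finally show ?thesis .
  qed
  have "x \<in> S" using assms(2)
  proof (induction rule: int_adjoin_induct)
    case one
    show ?case using fS[of 1 0 0 0] by (simp add: f_def)
  next
    case self
    show ?case using fS[of 0 1 0 0] by (simp add: f_def)
  next
    case (uminus x)
    show ?case using scale[OF uminus, of "-1"] by simp
  qed (use add mult in auto)
  thus ?thesis using that by (auto simp: S_def f_def)
qed

context quartic_tower_3
begin

lemma index_eta:
  assumes "\<not> 3 dvd t"
  shows "rat_adjoin \<eta> = K" "\<not> 3 dvd index_of K \<eta>"
proof -
  have "of_int t * \<epsilon> = \<eta>\<^sup>2 - of_int s" by (simp add: eta_sq)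
  also have "\<dots> \<in> int_adjoin \<eta>" by (intro int_adjoin_intros)
  finally have eps: "of_int t * \<epsilon> \<in> int_adjoin \<eta>" .
  have "of_int t * \<epsilon> * \<eta> \<in> int_adjoin \<eta>" by (intro int_adjoin_mult eps int_adjoin_self)
  hence "of_int t * (\<epsilon> * \<eta>) \<in> int_adjoin \<eta>" by (simp add: mult.assoc)
  moreover have "of_int t * \<eta> \<in> int_adjoin \<eta>" by (intro int_adjoin_intros)
  moreover have "\<eta> \<in> Ord" by (subst el_eta) simp
  ultimately show "rat_adjoin \<eta> = K" "\<not> 3 dvd index_of K \<eta>"
    using index_not_dvd_3[OF _ assms eps] by blast+
qed

text \<open>For \<theta> = (1 + \<epsilon>)\<eta>, the coefficient of \<epsilon> in
  \<open>\<theta>\<^sup>2\<close> is \<open>(1 + m) * t + 2 * s\<close>, and \<eta> is recovered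
  from (1 - \<epsilon>)\<theta> = (1 - m)\<eta>. Both integers must be prime to 3.\<close>

lemma index_eta_twist:
  assumes "\<not> 3 dvd (1 + m) * t + 2 * s" "\<not> 3 dvd 1 - m"
  shows "rat_adjoin (\<eta> + \<epsilon> * \<eta>) = K" "\<not> 3 dvd index_of K (\<eta> + \<epsilon> * \<eta>)"
proof -
  define \<theta> where "\<theta> = \<eta> + \<epsilon> * \<eta>"
  define t' where "t' = (1 + m) * t + 2 * s"
  have d: "\<not> 3 dvd t' * (1 - m)" using assms by (simp add: prime_dvd_mult_3 t'_def)
  have "of_int t' * \<epsilon> = \<theta>\<^sup>2 - of_int ((1 + m) * s + 2 * t * m)"
    by (simp add: \<theta>_def t'_def power2_eq_square algebra_simps eps_eps eta_eta)
  also have "\<dots> \<in> int_adjoin \<theta>" by (intro int_adjoin_diff int_adjoin_power int_adjoin_self int_adjoin_of_int)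
  finally have eps: "of_int t' * \<epsilon> \<in> int_adjoin \<theta>" .
  have "of_int (t' * (1 - m)) * \<epsilon> = of_int (1 - m) * (of_int t' * \<epsilon>)" by simp
  also have "\<dots> \<in> int_adjoin \<theta>" by (intro int_adjoin_mult eps int_adjoin_of_int)
  finally have 1: "of_int (t' * (1 - m)) * \<epsilon> \<in> int_adjoin \<theta>" .
  have "of_int (t' * (1 - m)) * \<eta> = of_int t' * \<theta> - of_int t' * \<epsilon> * \<theta>"
    by (simp add: \<theta>_def algebra_simps eps_eps)
  also have "\<dots> \<in> int_adjoin \<theta>"
    by (intro int_adjoin_diff int_adjoin_mult[OF eps] int_adjoin_mult[OF int_adjoin_of_int] int_adjoin_self)
  finally have 2: "of_int (t' * (1 - m)) * \<eta> \<in> int_adjoin \<theta>" .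
  have "of_int (t' * (1 - m)) * (\<epsilon> * \<eta>) = of_int t' * \<epsilon> * \<theta> - of_int (m * t') * \<theta>"
    by (simp add: \<theta>_def algebra_simps eps_eps)
  also have "\<dots> \<in> int_adjoin \<theta>"
    by (intro int_adjoin_diff int_adjoin_mult[OF eps] int_adjoin_mult[OF int_adjoin_of_int] int_adjoin_self)
  finally have 3: "of_int (t' * (1 - m)) * (\<epsilon> * \<eta>) \<in> int_adjoin \<theta>" .
  have "\<theta> = el 0 0 1 1" by (simp add: \<theta>_def el_def algebra_simps)
  hence "\<theta> \<in> Ord" by simp
  from index_not_dvd_3[OF this d 1 2 3] show "rat_adjoin (\<eta> + \<epsilon> * \<eta>) = K" "\<not> 3 dvd index_of K (\<eta> + \<epsilon> * \<eta>)"
    by (simp_all add: \<theta>_def)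
qed

text \<open>\<open>\<Delta> p\<close> is, up to sign, the determinant of \<open>\<theta>, \<theta>\<^sup>2, \<theta>\<^sup>3\<close> modulo \<open>\<int>\<close> in the basis \<open>\<epsilon>, \<eta>, \<epsilon>\<eta>\<close>,
  for \<open>\<theta> = p \<epsilon> + \<eta>\<close>.\<close>

definition \<Delta> :: "int \<Rightarrow> int" where "\<Delta> p = 4 * p\<^sup>2 * (s - p\<^sup>2 * m) - t\<^sup>2"

lemma theta_square: "(of_int p * \<epsilon> + \<eta>)\<^sup>2 = el (p\<^sup>2 * m + s) t 0 (2 * p)"
  by (simp add: el_def algebra_simps eps_eps eta_eta power2_eq_square)

lemma theta_cube:
  "(of_int p * \<epsilon> + \<eta>) ^ 3 = el (3 * p * t * m) (p * (p\<^sup>2 * m + 3 * s)) (3 * p\<^sup>2 * m + s) t"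
  by (simp add: el_def algebra_simps eps_eps eta_eta power2_eq_square power3_eq_cube)

lemma theta_adjoin:
  fixes p defines "\<theta> \<equiv> of_int p * \<epsilon> + \<eta>" and "d \<equiv> 2 * p * \<Delta> p"
  shows "\<theta> \<in> Ord" "of_int d * \<epsilon> \<in> int_adjoin \<theta>" "of_int d * \<eta> \<in> int_adjoin \<theta>"
    "of_int d * (\<epsilon> * \<eta>) \<in> int_adjoin \<theta>"
proof -
  have "\<theta> = el 0 p 1 0" by (simp add: \<theta>_def el_def)
  thus "\<theta> \<in> Ord" by simp
  \<comment> \<open>The combination of \<theta>, \<open>\<theta>\<^sup>2\<close>,
    \<open>\<theta> ^ 3\<close> in which the coefficients of \<eta> and \<epsilon>\<eta> cancel. The
    further factor \<open>2 * p\<close> in d is the coefficient of \<epsilon>\<eta> in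
    \<open>\<theta>\<^sup>2\<close>.\<close>
  have "of_int (\<Delta> p) * \<epsilon> = of_int (2 * p) * \<theta> ^ 3 - of_int t * \<theta>\<^sup>2 - of_int (2 * p * (3 * p\<^sup>2 * m + s)) * \<theta>
      - of_int (2 * p * (3 * p * t * m) - t * (p\<^sup>2 * m + s))"
    unfolding \<theta>_def theta_square theta_cube \<Delta>_def
    by (simp add: el_def algebra_simps power2_eq_square)
  also have "\<dots> \<in> int_adjoin \<theta>"
    by (intro int_adjoin_diff int_adjoin_mult int_adjoin_power int_adjoin_self int_adjoin_of_int)
  finally have eps: "of_int (\<Delta> p) * \<epsilon> \<in> int_adjoin \<theta>" .
  have "of_int d * \<epsilon> = of_int (2 * p) * (of_int (\<Delta> p) * \<epsilon>)" by (simp add: d_def)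
  also have "\<dots> \<in> int_adjoin \<theta>" by (intro int_adjoin_mult eps int_adjoin_of_int)
  finally show eps': "of_int d * \<epsilon> \<in> int_adjoin \<theta>" .
  have "of_int d * \<eta> = of_int d * \<theta> - of_int p * (of_int d * \<epsilon>)"
    by (simp add: \<theta>_def algebra_simps)
  also have "\<dots> \<in> int_adjoin \<theta>"
    by (intro int_adjoin_diff int_adjoin_mult[OF int_adjoin_of_int] int_adjoin_self eps')
  finally show "of_int d * \<eta> \<in> int_adjoin \<theta>" .
  have "of_int d * (\<epsilon> * \<eta>)
      = of_int (\<Delta> p) * \<theta>\<^sup>2 - of_int (\<Delta> p * (p\<^sup>2 * m + s)) - of_int t * (of_int (\<Delta> p) * \<epsilon>)"
    unfolding \<theta>_def theta_square d_def by (simp add: el_def algebra_simps)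
  also have "\<dots> \<in> int_adjoin \<theta>"
    by (intro int_adjoin_diff int_adjoin_mult[OF int_adjoin_of_int] int_adjoin_power int_adjoin_self
        int_adjoin_of_int eps)
  finally show "of_int d * (\<epsilon> * \<eta>) \<in> int_adjoin \<theta>" .
qed

lemma index_eps_eta:
  assumes "\<not> 3 dvd \<Delta> 1"
  shows "rat_adjoin (\<epsilon> + \<eta>) = K" "\<not> 3 dvd index_of K (\<epsilon> + \<eta>)"
proof -
  have "\<not> 3 dvd 2 * 1 * \<Delta> 1" using assms by presburger
  from index_not_dvd_3[OF theta_adjoin(1)[of 1] this theta_adjoin(2-4)[of 1]]
  show "rat_adjoin (\<epsilon> + \<eta>) = K" "\<not> 3 dvd index_of K (\<epsilon> + \<eta>)" by simp_all
qed

text \<open>The choice of p makes d = \<open>2 * p * \<Delta> p\<close> divisible by 3 exactly once.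
  A class killed by 9 lies in the order and is killed by d, hence by gcd(d, 9) = 3. Comparing
  coordinates modulo 3 leaves only the multiples of one class w, so there are at most three such
  classes rather than nine.\<close>

lemma index_theta_not_dvd_9:
  assumes split: "[m = 1] (mod 3)" "[s = 1] (mod 3)" "[t = 0] (mod 3)"
    and p: "\<not> 3 dvd p" "\<not> 9 dvd s - p\<^sup>2 * m"
  defines "\<theta> \<equiv> of_int p * \<epsilon> + \<eta>"
  shows "\<theta> \<in> R" "rat_adjoin \<theta> = K" "\<not> 9 dvd index_of K \<theta>"
proof -
  define d where "d = 2 * p * \<Delta> p"
  note th = theta_adjoin[of p, folded \<theta>_def d_def]
  show \<theta>R: "\<theta> \<in> R" using th(1) Ord_subset by blast
  have p2: "[p\<^sup>2 = 1] (mod 3)"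
  proof -
    have "p mod 3 = 1 \<or> p mod 3 = 2" using p(1) by presburger
    moreover have "p\<^sup>2 mod 3 = (p mod 3)\<^sup>2 mod 3" by (simp add: power_mod)
    ultimately show ?thesis unfolding cong_def by auto
  qed
  obtain d' where d': "d = 3 * d'" "\<not> 3 dvd d'"
  proof -
    obtain t' where t': "t = 3 * t'" using split(3) by (auto simp: cong_0_iff)
    have "[s - p\<^sup>2 * m = 1 - 1 * 1] (mod 3)" by (intro cong_diff cong_mult split p2)
    then obtain j where j: "s - p\<^sup>2 * m = 3 * j" by (auto simp: cong_0_iff)
    have "\<not> 3 dvd j" using p(2) unfolding j by presburger
    have "\<not> 3 dvd 4 * p\<^sup>2 * j - 3 * t'\<^sup>2"
    proof
      assume "3 dvd 4 * p\<^sup>2 * j - 3 * t'\<^sup>2"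
      hence "3 dvd 4 * p\<^sup>2 * j" by (simp add: dvd_diff_left_iff)
      thus False using p(1) \<open>\<not> 3 dvd j\<close> by (simp add: prime_dvd_mult_3 power2_eq_square)
    qed
    moreover have "\<not> (3 :: int) dvd 2" by simp
    ultimately have nd: "\<not> 3 dvd 2 * p * (4 * p\<^sup>2 * j - 3 * t'\<^sup>2)"
      using p(1) unfolding prime_dvd_mult_3 by blast
    have "\<Delta> p = 3 * (4 * p\<^sup>2 * j - 3 * t'\<^sup>2)"
      unfolding \<Delta>_def j by (simp add: t' power2_eq_square)
    hence "d = 3 * (2 * p * (4 * p\<^sup>2 * j - 3 * t'\<^sup>2))" by (simp add: d_def)
    from that[OF this nd] show ?thesis .
  qed
  have d0: "d \<noteq> 0" using d' by auto
  show "rat_adjoin \<theta> = K" using rat_adjoin_eq_K[OF _ d0 th(2,3)] \<theta>R by (simp add: ring_of_integers_def)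
  interpret complex_subgroups R "int_adjoin \<theta>"
    by (rule complex_subgroups_int_adjoin[OF sub_field_K \<theta>R])
  define A where "A = p\<^sup>2 * m + s"
  \<comment> \<open>Here \<open>\<theta>\<^sup>2 - A\<close> is \<epsilon>(t + 2p\<eta>); in its
    square the terms with \<eta> and \<epsilon> combine to \<open>4 * p * t * m\<close> times \<eta>
    + p\<epsilon> = \<theta>.\<close>
  have "(\<theta>\<^sup>2 - of_int A)\<^sup>2 = of_int (m * (t\<^sup>2 + 4 * p\<^sup>2 * s)) + of_int (4 * p * t * m) * \<theta>"
    unfolding \<theta>_def theta_square A_def el_def
    by (simp add: algebra_simps eps_eps eta_eta power2_eq_square)
  hence quartic: "\<theta> ^ 4 = of_int (m * (t\<^sup>2 + 4 * p\<^sup>2 * s) - A\<^sup>2) + of_int (4 * p * t * m) * \<theta>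
      + of_int (2 * A) * \<theta>\<^sup>2 + of_int 0 * \<theta> ^ 3"
    by (simp add: algebra_simps power2_eq_square power4_eq_xxxx)
  \<comment> \<open>Modulo 3 the order is a product of copies of Z/3, so \<open>\<theta> ^ 3\<close>
    and \<theta> agree there; dividing their difference by 3 gives the one new class.\<close>
  define w where "w = (\<theta> ^ 3 - \<theta>) / 3"
  have "\<not> 3 ^ 2 dvd card cosets"
  proof (rule not_prime_power_dvd_index[where C = "(\<lambda>c. of_int c * w) ` {0..<3}"])
    show "finite cosets" by (rule finite_index[OF \<theta>R d0 Ord_mult_int_adjoin[OF th(2-4)]])
    have "card ((\<lambda>c. of_int c * w) ` {0..<3}) \<le> card {0..<3::int}" by (rule card_image_le) simp
    thus "card ((\<lambda>c. of_int c * w) ` {0..<3}) < 3 ^ 2" by simp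
    fix x assume x: "x \<in> R" "of_nat (3 ^ 2) * x \<in> int_adjoin \<theta>"
    hence 9: "9 * x \<in> int_adjoin \<theta>" by simp
    hence "9 * x \<in> Ord" using int_adjoin_subset_Ord[OF th(1)] by blast
    hence xO: "x \<in> Ord" using maximal_power[OF x(1), of 2] by simp
    from Ord_mult_int_adjoin[OF th(2-4) this] have "of_int (gcd d 9) * x \<in> int_adjoin \<theta>"
      using 9 by (intro int_adjoin_cancel) auto
    moreover have "gcd d 9 = 3"
    proof -
      have "gcd (3 * d') (3 * 3) = 3 * gcd d' 3" using gcd_mult_distrib_int[of 3 d' 3] by simp
      also have "gcd d' 3 = 1"
        using not_3_dvd_imp_coprime[OF d'(2)] by (simp add: coprime_iff_gcd_eq_1 gcd.commute)
      finally show ?thesis using d' by simp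
    qed
    ultimately have "3 * x \<in> int_adjoin \<theta>" by simp
    from int_adjoin_quartic[OF quartic this] obtain c0 c1 c2 c3
      where c: "3 * x = of_int c0 + of_int c1 * \<theta> + of_int c2 * \<theta>\<^sup>2 + of_int c3 * \<theta> ^ 3" by metis
    obtain x0 x1 x2 x3 where x': "x = el x0 x1 x2 x3" using xO by (rule OrdE)
    have "el (3 * x0) (3 * x1) (3 * x2) (3 * x3) =
      el (c0 + c2 * A + c3 * (3 * p * t * m)) (c1 * p + c2 * t + c3 * (p * (p\<^sup>2 * m + 3 * s)))
         (c1 + c3 * (3 * p\<^sup>2 * m + s)) (c2 * (2 * p) + c3 * t)"
    proof -
      have "el (3 * x0) (3 * x1) (3 * x2) (3 * x3) = 3 * x" using el_scale[of 3] by (simp add: x')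
      also have "\<dots> = of_int c0 + of_int c1 * \<theta> + of_int c2 * \<theta>\<^sup>2 + of_int c3 * \<theta> ^ 3" by (fact c)
      finally show ?thesis unfolding \<theta>_def theta_square theta_cube A_def[symmetric]
        by (simp add: el_def algebra_simps)
    qed
    hence e: "3 * x0 = c0 + c2 * A + c3 * (3 * p * t * m)" "3 * x2 = c1 + c3 * (3 * p\<^sup>2 * m + s)"
      "3 * x3 = c2 * (2 * p) + c3 * t" by (simp_all only: el_inject)
    obtain t' where t': "t = 3 * t'" using split(3) by (auto simp: cong_0_iff)
    obtain s' where "s - 1 = 3 * s'" using split(2) by (auto simp: cong_iff_dvd_diff)
    hence st: "t = 3 * t'" "s = 1 + 3 * s'" using t' by simp_all
    have "c2 * (2 * p) = 3 * (x3 - c3 * t')" using e(3) by (simp add: st)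
    hence "3 dvd c2 * (2 * p)" by simp
    hence "3 dvd c2" using p(1) by (simp add: prime_dvd_mult_3)
    then obtain k2 where k2: "c2 = 3 * k2" by auto
    obtain k0 where k0: "c0 = 3 * k0"
      using e(1) by (intro that[of "x0 - k2 * A - c3 * (p * t * m)"]) (simp add: k2)
    obtain k1 where k1: "c1 = 3 * k1 - c3"
      using e(2) by (intro that[of "x2 - c3 * (p\<^sup>2 * m + s')"]) (simp add: st algebra_simps)
    \<comment> \<open>Three times the quotient in \<open>c3\<close> gives an element of Z[\<theta>];
      the remainder j alone decides the class of x.\<close>
    obtain i j where c3: "c3 = 3 * i + j" "0 \<le> j" "j < 3"
      by (rule that[of "c3 div 3" "c3 mod 3"]) simp_all
    have w: "\<theta> ^ 3 = 3 * w + \<theta>" by (simp add: w_def)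
    have "3 * x = 3 * (of_int k0 + of_int k1 * \<theta> + of_int k2 * \<theta>\<^sup>2 + of_int i * (\<theta> ^ 3 - \<theta>) + of_int j * w)"
      unfolding c k0 k1 k2 w c3(1) by (simp add: algebra_simps)
    hence "x = of_int k0 + of_int k1 * \<theta> + of_int k2 * \<theta>\<^sup>2 + of_int i * (\<theta> ^ 3 - \<theta>) + of_int j * w"
      unfolding mult_cancel_left by simp
    hence "x - of_int j * w = of_int k0 + of_int k1 * \<theta> + of_int k2 * \<theta>\<^sup>2 + of_int i * (\<theta> ^ 3 - \<theta>)"
      by simp
    also have "\<dots> \<in> int_adjoin \<theta>"
      by (intro int_adjoin_add int_adjoin_diff int_adjoin_mult int_adjoin_power int_adjoin_self int_adjoin_of_int)
    finally show "\<exists>c\<in>(\<lambda>c. of_int c * w) ` {0..<3}. x - c \<in> int_adjoin \<theta>" using c3(2,3) by auto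
  qed auto
  thus "\<not> 9 dvd index_of K \<theta>" by (simp add: index_of_def)
qed

end

section \<open>The totally split case\<close>

context quartic_tower_3
begin

definition totally_split :: bool
  where "totally_split \<longleftrightarrow> [m = 1] (mod 3) \<and> [s = 1] (mod 3) \<and> [t = 0] (mod 3)"

text \<open>In the totally split case the four sign choices \<open>e, f\<close> of \<open>\<epsilon> \<mapsto> e\<close>, \<open>\<eta> \<mapsto> f\<close> induce the four
  ring homomorphisms from the order to \<open>\<int>/3\<int>\<close>.\<close>

definition red :: "int \<times> int \<Rightarrow> int \<Rightarrow> int \<Rightarrow> int \<Rightarrow> int \<Rightarrow> int"
  where "red = (\<lambda>(e, f) p q r u. p + e * q + f * r + e * f * u)"

definition signs :: "(int \<times> int) set" where "signs = {1, -1} \<times> {1, -1}"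

text \<open>Modulo 3 the structure constants may be replaced by m = s = 1 and t = 0; then
  multiplicativity is an identity in signs with e^2 = f^2 = 1.\<close>

lemma red_mult:
  fixes p q r u p' q' r' u' :: int
  assumes "totally_split" "\<sigma> \<in> signs"
  defines "P \<equiv> r * r' + m * u * u'" and "Q \<equiv> r * u' + u * r'"
  shows "[red \<sigma> (p * p' + m * q * q' + P * s + Q * t * m) (p * q' + q * p' + P * t + Q * s)
       (p * r' + m * q * u' + r * p' + m * u * q') (p * u' + q * r' + r * q' + u * p')
       = red \<sigma> p q r u * red \<sigma> p' q' r' u'] (mod 3)"
proof -
  have m: "[m = 1] (mod 3)" "[s = 1] (mod 3)" "[t = 0] (mod 3)"
    using assms(1) by (auto simp: totally_split_def)
  obtain e f where \<sigma>: "\<sigma> = (e, f)" by (cases \<sigma>)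
  have P: "[P = r * r' + 1 * u * u'] (mod 3)"
    unfolding P_def by (intro cong_add cong_mult cong_refl m)
  have "[red \<sigma> (p * p' + m * q * q' + P * s + Q * t * m) (p * q' + q * p' + P * t + Q * s)
       (p * r' + m * q * u' + r * p' + m * u * q') (p * u' + q * r' + r * q' + u * p')
    = red \<sigma> (p * p' + 1 * q * q' + (r * r' + 1 * u * u') * 1 + Q * 0 * 1)
       (p * q' + q * p' + (r * r' + 1 * u * u') * 0 + Q * 1)
       (p * r' + 1 * q * u' + r * p' + 1 * u * q') (p * u' + q * r' + r * q' + u * p')] (mod 3)"
    unfolding red_def \<sigma> prod.case by (intro cong_add cong_mult cong_refl m P)
  also have "red \<sigma> (p * p' + 1 * q * q' + (r * r' + 1 * u * u') * 1 + Q * 0 * 1)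
       (p * q' + q * p' + (r * r' + 1 * u * u') * 0 + Q * 1)
       (p * r' + 1 * q * u' + r * p' + 1 * u * q') (p * u' + q * r' + r * q' + u * p')
    = red \<sigma> p q r u * red \<sigma> p' q' r' u'"
    using assms(2) unfolding signs_def by (auto simp: red_def Q_def algebra_simps)
  finally show ?thesis .
qed

lemma red_scale: "red \<sigma> (k * p) (k * q) (k * r) (k * u) = k * red \<sigma> p q r u"
  and red_add: "red \<sigma> (p + p') (q + q') (r + r') (u + u') = red \<sigma> p q r u + red \<sigma> p' q' r' u'"
  by (simp_all add: red_def algebra_simps split: prod.split)

lemma red_pigeonhole:
  obtains \<sigma> \<tau> where "\<sigma> \<in> signs" "\<tau> \<in> signs" "\<sigma> \<noteq> \<tau>" "[red \<sigma> p q r u = red \<tau> p q r u] (mod 3)"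
proof -
  have "\<not> inj_on (\<lambda>\<sigma>. red \<sigma> p q r u mod 3) signs"
  proof
    assume "inj_on (\<lambda>\<sigma>. red \<sigma> p q r u mod 3) signs"
    moreover have "(\<lambda>\<sigma>. red \<sigma> p q r u mod 3) ` signs \<subseteq> {0..<3}" by auto
    ultimately have "card signs \<le> card {0..<3::int}" by (intro card_inj_on_le) auto
    thus False by (simp add: signs_def)
  qed
  thus ?thesis using that by (auto simp: inj_on_def cong_def)
qed

text \<open>An element of R need not lie in the order, only a multiple by some k prime to 3 does.
  Allowing k extends both homomorphisms to R, since k is invertible modulo 3.\<close>

definition agree :: "int \<times> int \<Rightarrow> int \<times> int \<Rightarrow> complex \<Rightarrow> bool"
  where "agree \<sigma> \<tau> x \<longleftrightarrow> (\<exists>k p q r u. \<not> 3 dvd k \<and> of_int k * x = el p q r u \<and>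
    [red \<sigma> p q r u = red \<tau> p q r u] (mod 3))"

text \<open>Two ring homomorphisms agree on a subring, so agreement at \<theta> spreads to
  Z[\<theta>]; the multipliers k are multiplied along.\<close>

lemma agree_int_adjoin:
  assumes split: totally_split and \<sigma>: "\<sigma> \<in> signs" "\<tau> \<in> signs" and \<theta>: "agree \<sigma> \<tau> \<theta>"
    and "x \<in> int_adjoin \<theta>"
  shows "agree \<sigma> \<tau> x"
  using assms(5)
proof (induction rule: int_adjoin_induct)
  case one
  have "of_int 1 * 1 = el 1 0 0 0" "[red \<sigma> 1 0 0 0 = red \<tau> 1 0 0 0] (mod 3)" "\<not> 3 dvd (1 :: int)"
    by (auto simp: el_def red_def split: prod.split)
  thus ?case unfolding agree_def by blast
next
  case self
  show ?case by (fact \<theta>)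
next
  case (uminus x)
  then obtain k p q r u where x: "\<not> 3 dvd k" "of_int k * x = el p q r u"
    "[red \<sigma> p q r u = red \<tau> p q r u] (mod 3)" unfolding agree_def by blast
  have "\<not> 3 dvd - k" "of_int (- k) * - x = el p q r u" using x by auto
  thus ?case using x(3) unfolding agree_def by blast
next
  case (add x y)
  from add(1) obtain k p q r u where x: "\<not> 3 dvd k" "of_int k * x = el p q r u"
    "[red \<sigma> p q r u = red \<tau> p q r u] (mod 3)" unfolding agree_def by blast
  from add(2) obtain k' p' q' r' u' where y: "\<not> 3 dvd k'" "of_int k' * y = el p' q' r' u'"
    "[red \<sigma> p' q' r' u' = red \<tau> p' q' r' u'] (mod 3)" unfolding agree_def by blast
  have "of_int (k * k') * (x + y) = of_int k' * (of_int k * x) + of_int k * (of_int k' * y)"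
    by (simp add: algebra_simps)
  also have "\<dots> = el (k' * p + k * p') (k' * q + k * q') (k' * r + k * r') (k' * u + k * u')"
    unfolding x y el_scale el_add ..
  finally have "of_int (k * k') * (x + y)
    = el (k' * p + k * p') (k' * q + k * q') (k' * r + k * r') (k' * u + k * u')" .
  moreover have "\<not> 3 dvd k * k'" using x y by (simp add: prime_dvd_mult_3)
  moreover have "[red \<sigma> (k' * p + k * p') (k' * q + k * q') (k' * r + k * r') (k' * u + k * u')
    = red \<tau> (k' * p + k * p') (k' * q + k * q') (k' * r + k * r') (k' * u + k * u')] (mod 3)"
    unfolding red_add red_scale by (intro cong_add cong_mult cong_refl x y)
  ultimately show ?case unfolding agree_def by blast
next
  case (mult x y)
  from mult(1) obtain k p q r u where x: "\<not> 3 dvd k" "of_int k * x = el p q r u"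
    "[red \<sigma> p q r u = red \<tau> p q r u] (mod 3)" unfolding agree_def by blast
  from mult(2) obtain k' p' q' r' u' where y: "\<not> 3 dvd k'" "of_int k' * y = el p' q' r' u'"
    "[red \<sigma> p' q' r' u' = red \<tau> p' q' r' u'] (mod 3)" unfolding agree_def by blast
  define P Q where "P = r * r' + m * u * u'" and "Q = r * u' + u * r'"
  define a b c d where "a = p * p' + m * q * q' + P * s + Q * t * m" and "b = p * q' + q * p' + P * t + Q * s"
    and "c = p * r' + m * q * u' + r * p' + m * u * q'" and "d = p * u' + q * r' + r * q' + u * p'"
  note defs = P_def Q_def a_def b_def c_def d_def
  have "of_int (k * k') * (x * y) = (of_int k * x) * (of_int k' * y)" by simp
  also have "\<dots> = el a b c d" unfolding x y el_mult Let_def defs ..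
  finally have "of_int (k * k') * (x * y) = el a b c d" .
  moreover have "\<not> 3 dvd k * k'" using x y by (simp add: prime_dvd_mult_3)
  moreover have "[red \<sigma> a b c d = red \<tau> a b c d] (mod 3)"
  proof -
    have "[red \<sigma> a b c d = red \<sigma> p q r u * red \<sigma> p' q' r' u'] (mod 3)"
      unfolding defs by (rule red_mult[OF split \<sigma>(1)])
    also have "[red \<sigma> p q r u * red \<sigma> p' q' r' u' = red \<tau> p q r u * red \<tau> p' q' r' u'] (mod 3)"
      by (intro cong_mult x y)
    also have "[red \<tau> p q r u * red \<tau> p' q' r' u' = red \<tau> a b c d] (mod 3)"
      unfolding defs by (rule cong_sym[OF red_mult[OF split \<sigma>(2)]])
    finally show ?thesis .
  qed
  ultimately show ?case unfolding agree_def by blast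
qed

text \<open>If the index i were prime to 3, then Z[\<theta>] would contain i\<epsilon> and i\<eta>.
  The two homomorphisms that agree on \<theta> would then agree on \<epsilon> and \<eta>, whose
  images are the signs themselves.\<close>

lemma index_dvd_3:
  assumes totally_split and \<theta>: "\<theta> \<in> R"
  shows "3 dvd index_of K \<theta>"
proof (rule ccontr)
  interpret complex_subgroups R "int_adjoin \<theta>"
    by (rule complex_subgroups_int_adjoin[OF sub_field_K \<theta>])
  define i where "i = int (card cosets)"
  assume "\<not> 3 dvd index_of K \<theta>"
  hence i: "\<not> 3 dvd card cosets" by (simp add: index_of_def)
  hence i3: "\<not> 3 dvd i" unfolding i_def using of_nat_dvd_iff[of 3 "card cosets"] by simp
  \<comment> \<open>An infinite quotient has \<open>card\<close> 0, which 3 divides; so the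
    assumption to be refuted supplies finiteness.\<close>
  have "finite cosets" using i by (metis card.infinite dvd_0_right)
  hence mem: "of_int i * x \<in> int_adjoin \<theta>" if "x \<in> R" for x
    using card_cosets_mult[of x] that by (simp add: i_def)
  obtain n where n: "\<not> 3 dvd n" "of_int n * \<theta> \<in> Ord"
    using prime_to_3_mult_in_Ord \<theta> by metis
  obtain p q r u where el: "of_int n * \<theta> = el p q r u" using n(2) by (rule OrdE)
  obtain \<sigma> \<tau> where \<sigma>: "\<sigma> \<in> signs" "\<tau> \<in> signs" "\<sigma> \<noteq> \<tau>" "[red \<sigma> p q r u = red \<tau> p q r u] (mod 3)"
    by (rule red_pigeonhole)
  have agree: "agree \<sigma> \<tau> (of_int i * x)" if "x \<in> R" for x
    using agree_int_adjoin[OF assms(1) \<sigma>(1,2) _ mem[OF that]] n(1) el \<sigma>(4) unfolding agree_def by blast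
  have "fst \<sigma> = fst \<tau>"
  proof -
    have "\<epsilon> \<in> R" using eps_K algebraic_int_eps by (simp add: ring_of_integers_def)
    from agree[OF this] obtain k a b c d where k: "\<not> 3 dvd k" "of_int k * (of_int i * \<epsilon>) = el a b c d"
      "[red \<sigma> a b c d = red \<tau> a b c d] (mod 3)" unfolding agree_def by blast
    have "el 0 (k * i) 0 0 = el a b c d" using k(2) by (simp add: el_def mult.assoc)
    hence "[fst \<sigma> * (k * i) = fst \<tau> * (k * i)] (mod 3)"
      using k(3) by (simp add: el_inject red_def split: prod.splits)
    hence "3 dvd (fst \<sigma> - fst \<tau>) * (k * i)" by (simp add: cong_iff_dvd_diff algebra_simps)
    thus ?thesis using \<sigma>(1,2) i3 k(1) by (auto simp: prime_dvd_mult_3 signs_def)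
  qed
  moreover have "snd \<sigma> = snd \<tau>"
  proof -
    have "\<eta> \<in> R" using eta_K algebraic_int_eta by (simp add: ring_of_integers_def)
    from agree[OF this] obtain k a b c d where k: "\<not> 3 dvd k" "of_int k * (of_int i * \<eta>) = el a b c d"
      "[red \<sigma> a b c d = red \<tau> a b c d] (mod 3)" unfolding agree_def by blast
    have "el 0 0 (k * i) 0 = el a b c d" using k(2) by (simp add: el_def mult.assoc)
    hence "[snd \<sigma> * (k * i) = snd \<tau> * (k * i)] (mod 3)"
      using k(3) by (simp add: el_inject red_def split: prod.splits)
    hence "3 dvd (snd \<sigma> - snd \<tau>) * (k * i)" by (simp add: cong_iff_dvd_diff algebra_simps)
    thus ?thesis using \<sigma>(1,2) i3 k(1) by (auto simp: prime_dvd_mult_3 signs_def)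
  qed
  ultimately show False using \<sigma>(3) by (simp add: prod_eq_iff)
qed

text \<open>With R = Z[\<theta>] the quotient is trivial: a constant map shows it finite, and
  \<open>C = {0}\<close> shows that 3 does not divide its order.\<close>

lemma not_monogenic:
  assumes totally_split
  shows "\<not> monogenic K"
proof
  assume "monogenic K"
  then obtain \<theta> where \<theta>: "\<theta> \<in> R" "R = int_adjoin \<theta>" unfolding monogenic_def by blast
  interpret complex_subgroups R "int_adjoin \<theta>"
    by (rule complex_subgroups_int_adjoin[OF sub_field_K \<theta>(1)])
  have "finite ((\<lambda>_. ()) ` R)" by simp
  hence "finite cosets" by (rule finite_cosets) (use diff_R \<theta>(2) in auto)
  hence "\<not> 3 ^ 1 dvd card cosets"
    by (intro not_prime_power_dvd_index[where C = "{0}"]) (use \<theta>(2) in auto)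
  thus False using index_dvd_3[OF assms \<theta>(1)] by (simp add: index_of_def)
qed

lemma field_index_dvd: "\<theta> \<in> R \<Longrightarrow> rat_adjoin \<theta> = K \<Longrightarrow> field_index K dvd index_of K \<theta>"
  unfolding field_index_def by (rule Gcd_dvd) auto

text \<open>If t is prime to 3, \<eta> works. If 3 divides t, then \<open>\<Delta> 1\<close> is
  congruent to s - m, so \<epsilon> + \<eta> works unless s and m agree modulo 3. Their common
  residue is not 0 by \<open>sqfree\<close>, nor 1 as this is the split case; for residue 2 the
  twist (1 + \<epsilon>)\<eta> works.\<close>

lemma field_index_not_split:
  assumes "\<not> totally_split"
  shows "\<not> 3 dvd field_index K"
proof -
  have "\<exists>\<theta> \<in> R. rat_adjoin \<theta> = K \<and> \<not> 3 dvd index_of K \<theta>"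
  proof (cases "3 dvd t")
    case False
    have "\<eta> \<in> R" using eta_K algebraic_int_eta by (simp add: ring_of_integers_def)
    thus ?thesis using index_eta[OF False] by blast
  next
    case t: True
    show ?thesis
    proof (cases "3 dvd s - m")
      case False
      have "\<not> 3 dvd \<Delta> 1"
      proof
        assume "3 dvd \<Delta> 1"
        hence "3 dvd 4 * (s - m)" using t by (simp add: \<Delta>_def dvd_diff_left_iff power2_eq_square)
        thus False using False by presburger
      qed
      moreover have "\<epsilon> + \<eta> \<in> R"
        using theta_adjoin(1)[of 1] Ord_subset by auto
      ultimately show ?thesis using index_eps_eta by blast
    next
      case True
      have "\<not> 3 dvd m"
      proof
        assume m: "3 dvd m"
        hence "3 dvd s" using True by presburger
        \<comment> \<open>With r = 0 and u = 1: if 3 divided m, s and t, then 9 would divide both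
          coordinates of \<open>\<epsilon>\<^sup>2 * \<eta>\<^sup>2\<close>, although 3 does not
          divide \<epsilon>.\<close>
        hence "3 * 3 dvd m * s" "3 * 3 dvd m * t" using m t mult_dvd_mono by blast+
        hence "3 dvd (0::int) \<and> 3 dvd (1::int)"
          using sqfree[unfolded sqfree_at_3_def, rule_format, of 0 1] by simp
        thus False by simp
      qed
      moreover have "\<not> [m = 1] (mod 3)"
      proof
        assume "[m = 1] (mod 3)"
        hence "totally_split" using True t unfolding totally_split_def cong_def by presburger
        thus False using assms by simp
      qed
      ultimately have m: "m mod 3 = 2" unfolding cong_def by presburger
      have "\<not> 3 dvd (1 + m) * t + 2 * s"
      proof
        assume "3 dvd (1 + m) * t + 2 * s"
        hence "3 dvd 2 * s" using t by (simp add: dvd_add_right_iff)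
        thus False using m True by presburger
      qed
      moreover have "\<not> 3 dvd 1 - m" using m by presburger
      moreover have "\<eta> + \<epsilon> * \<eta> \<in> R"
        using eps_K eta_K algebraic_int_eps algebraic_int_eta sub_field_K
        by (simp add: ring_of_integers_def sub_field.add sub_field.mult algebraic_int_plus algebraic_int_times)
      ultimately show ?thesis using index_eta_twist by blast
    qed
  qed
  thus ?thesis using field_index_dvd dvd_trans by blast
qed

lemma field_index_split:
  assumes totally_split
  shows "3 dvd field_index K" "\<not> 9 dvd field_index K"
proof -
  show "3 dvd field_index K"
    unfolding field_index_def by (rule Gcd_greatest) (auto intro: index_dvd_3[OF assms])
  have split: "[m = 1] (mod 3)" "[s = 1] (mod 3)" "[t = 0] (mod 3)"
    using assms by (auto simp: totally_split_def)
  \<comment> \<open>The values for p = 1 and p = 2 differ by 3m with m prime to 3, so 9 cannot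
    divide both.\<close>
  have "\<exists>p. \<not> 3 dvd p \<and> \<not> 9 dvd s - p\<^sup>2 * m"
  proof (cases "9 dvd s - m")
    case True
    hence "\<not> 9 dvd s - 2\<^sup>2 * m" using split(1) unfolding cong_def by simp presburger
    thus ?thesis by (intro exI[of _ 2]) simp
  next
    case False
    thus ?thesis by (intro exI[of _ 1]) simp
  qed
  then obtain p where p: "\<not> 3 dvd p" "\<not> 9 dvd s - p\<^sup>2 * m" by blast
  show "\<not> 9 dvd field_index K"
    using index_theta_not_dvd_9[OF split p] field_index_dvd dvd_trans by blast
qed

theorem field_index_3:
  shows "3 dvd field_index K \<longleftrightarrow> totally_split"
    and "totally_split \<Longrightarrow> \<not> monogenic K \<and> \<nu> 3 (int (field_index K)) = 1"
proof -
  show "3 dvd field_index K \<longleftrightarrow> totally_split"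
    using field_index_split(1) field_index_not_split by blast
  assume split: totally_split
  note f = field_index_split[OF split]
  have "field_index K \<noteq> 0" using f(2) by (metis dvd_0_right)
  moreover have "multiplicity 3 (int (field_index K)) = 1"
  proof (rule multiplicity_eqI)
    show "3 ^ 1 dvd int (field_index K)" using f(1) of_nat_dvd_iff[of 3 "field_index K"] by simp
    show "\<not> 3 ^ Suc 1 dvd int (field_index K)" using f(2) of_nat_dvd_iff[of 9 "field_index K"] by simp
  qed
  ultimately show "\<not> monogenic K \<and> \<nu> 3 (int (field_index K)) = 1"
    using not_monogenic[OF split] by (simp add: padic_val_def one_enat_def)
qed

end

section \<open>Roots of biquadratic polynomials\<close>

lemma of_rat_poly_root_nonzero:
  fixes x :: complex
  assumes irr: "Factorial_Ring.irreducible p" and root: "poly (map_poly of_rat p) x = 0"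
    and q: "q \<noteq> 0" "degree q < degree p"
  shows "poly (map_poly of_rat q) x \<noteq> 0"
proof
  interpret h: map_poly_comm_ring_hom "of_rat :: rat \<Rightarrow> complex" ..
  assume q0: "poly (map_poly of_rat q) x = 0"
  have "\<not> p dvd q" using q dvd_imp_degree_le[of p q] by auto
  hence "Rings.coprime p q" using irr by (intro prime_elem_imp_coprime irreducible_imp_prime_elem)
  then obtain u v where "u * p + v * q = 1"
    by (metis bezout_coefficients_fst_snd coprime_imp_gcd_eq_1)
  hence "poly (map_poly of_rat (u * p + v * q)) x = (1 :: complex)" by simp
  thus False using root q0 by (simp add: h.hom_add h.hom_mult)
qed

text \<open>The consequences of irreducibility that a tower needs: \<alpha> has degree 2 over
  Q(\<open>\<alpha>\<^sup>2\<close>), whose elements are the p + q \<open>\<alpha>\<^sup>2\<close>,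
  and this field has degree 2 over Q.\<close>

locale biquadratic_root =
  fixes a b :: int and \<alpha> :: complex
  assumes root: "\<alpha> ^ 4 + of_int a * \<alpha>\<^sup>2 + of_int b = 0"
    and square_notin: "\<alpha>\<^sup>2 \<notin> \<rat>"
    and notin: "\<And>p q. p \<in> \<rat> \<Longrightarrow> q \<in> \<rat> \<Longrightarrow> \<alpha> \<noteq> p + q * \<alpha>\<^sup>2"
begin

text \<open>\<epsilon> generates the same quadratic field as \<open>\<alpha>\<^sup>2\<close>, and
  \<eta> is \<alpha> times a nonzero element of that field, so neither change affects K.\<close>

lemma tower:
  fixes c x y :: complex
  assumes c: "c \<in> \<rat>" "c \<noteq> 0" and xy: "x \<in> \<rat>" "y \<in> \<rat>" "x \<noteq> 0 \<or> y \<noteq> 0"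
    and \<epsilon>: "\<epsilon> = (2 * \<alpha>\<^sup>2 + of_int a) / c" "\<epsilon>\<^sup>2 = of_int m"
    and \<eta>: "\<eta> = (x + y * \<epsilon>) * \<alpha>" "\<eta>\<^sup>2 = of_int s + of_int t * \<epsilon>"
  shows "quartic_tower \<epsilon> \<eta> m s t" "quartic_tower.K \<epsilon> \<eta> = rat_adjoin \<alpha>"
proof -
  have sq: "\<alpha>\<^sup>2 = - of_int a / 2 + c / 2 * \<epsilon>" using c(2) by (simp add: \<epsilon>(1) field_simps)
  have eps: "\<epsilon> \<notin> \<rat>" using square_notin c(1) unfolding sq by auto
  have al: "\<alpha> \<notin> quad_ext \<rat> \<epsilon>"
  proof
    assume "\<alpha> \<in> quad_ext \<rat> \<epsilon>"
    then obtain p q where pq: "\<alpha> = p + q * \<epsilon>" "p \<in> \<rat>" "q \<in> \<rat>" by (auto simp: quad_ext_def)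
    have "(p + q * of_int a / c) + (2 * q / c) * \<alpha>\<^sup>2 = p + q * \<epsilon>"
      unfolding \<epsilon>(1) by (simp add: add_divide_distrib algebra_simps)
    hence "\<alpha> = (p + q * of_int a / c) + (2 * q / c) * \<alpha>\<^sup>2" using pq(1) by simp
    moreover have "p + q * of_int a / c \<in> \<rat>" "2 * q / c \<in> \<rat>" using pq c(1) by auto
    ultimately show False using notin by blast
  qed
  interpret Q: sub_field "\<rat> :: complex set" by (rule sub_field_Rats)
  interpret k: quadratic_ext "\<rat> :: complex set" \<epsilon>
    by unfold_locales (simp_all add: \<epsilon>(2) eps)
  interpret k': sub_field "quad_ext \<rat> \<epsilon>" by (rule k.sub_field_quad_ext)
  have nz: "x + y * \<epsilon> \<noteq> 0" using k.eq_0[OF xy(1,2)] xy(3) by auto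
  have xyk: "x + y * \<epsilon> \<in> quad_ext \<rat> \<epsilon>" by (rule quad_extI) (use xy in auto)
  have al_eq: "\<alpha> = \<eta> / (x + y * \<epsilon>)" using nz by (simp add: \<eta>(1))
  have "\<eta> \<notin> quad_ext \<rat> \<epsilon>" using k'.divide[OF _ xyk, of \<eta>] al al_eq by metis
  then show tower: "quartic_tower \<epsilon> \<eta> m s t" using \<epsilon>(2) \<eta>(2) eps by unfold_locales
  interpret quartic_tower \<epsilon> \<eta> m s t by (rule tower)
  interpret K: sub_field K by (rule sub_field_K)
  interpret A: sub_field "rat_adjoin \<alpha>" by (rule sub_field_rat_adjoin)
  have "\<alpha> \<in> K" unfolding al_eq using xy K.Rats by (intro K.divide K.add K.mult eps_K eta_K) auto
  hence "rat_adjoin \<alpha> \<subseteq> K" by (rule rat_adjoin_subset[OF sub_field_K])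
  moreover have "\<epsilon> \<in> rat_adjoin \<alpha>" unfolding \<epsilon>(1)
    using A.Rats c(1) by (intro A.divide A.add A.mult A.power A.of_int A.numeral mem_rat_adjoin) auto
  moreover from this have "\<eta> \<in> rat_adjoin \<alpha>" unfolding \<eta>(1)
    using A.Rats xy by (intro A.add A.mult mem_rat_adjoin) auto
  ultimately show "K = rat_adjoin \<alpha>"
    unfolding K_def quad_ext_def using A.Rats by (auto intro!: A.add A.mult)
qed

text \<open>The interface for the case distinction: each case supplies a scaling c, a multiplier
  \<open>x + y * \<epsilon>\<close> and its own reading \<open>C\<close> of the split
  condition.\<close>

lemma field_index_3_if_tower:
  fixes c x y :: complex
  assumes c: "c \<in> \<rat>" "c \<noteq> 0" and xy: "x \<in> \<rat>" "y \<in> \<rat>" "x \<noteq> 0 \<or> y \<noteq> 0"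
    and \<epsilon>: "\<epsilon> = (2 * \<alpha>\<^sup>2 + of_int a) / c" "\<epsilon>\<^sup>2 = of_int m"
    and \<eta>: "\<eta> = (x + y * \<epsilon>) * \<alpha>" "\<eta>\<^sup>2 = of_int s + of_int t * \<epsilon>"
    and m9: "\<not> 9 dvd m"
    and sqfree: "sqfree_at_3 m s t"
    and C: "C \<longleftrightarrow> [m = 1] (mod 3) \<and> [s = 1] (mod 3) \<and> [t = 0] (mod 3)"
  shows "(3 dvd field_index (rat_adjoin \<alpha>) \<longleftrightarrow> C)
       \<and> (C \<longrightarrow> \<not> monogenic (rat_adjoin \<alpha>) \<and> \<nu> 3 (int (field_index (rat_adjoin \<alpha>))) = 1)"
proof -
  note t = tower[OF c xy \<epsilon> \<eta>]
  interpret quartic_tower \<epsilon> \<eta> m s t by (rule t(1))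
  interpret quartic_tower_3 \<epsilon> \<eta> m s t by unfold_locales (fact m9, fact sqfree)
  show ?thesis using field_index_3 C unfolding t(2) totally_split_def by blast
qed

lemma square_square: "\<alpha>\<^sup>2 * \<alpha>\<^sup>2 = - of_int a * \<alpha>\<^sup>2 - of_int b"
  using root by (simp add: eq_neg_iff_add_eq_0 algebra_simps power2_eq_square power4_eq_xxxx)

lemma square_mult: "\<alpha>\<^sup>2 * (\<alpha>\<^sup>2 + of_int a) = - of_int b"
  unfolding distrib_left square_square by simp

lemma eps_square:
  assumes "c \<noteq> 0" "c\<^sup>2 * m = a\<^sup>2 - 4 * b"
  shows "((2 * \<alpha>\<^sup>2 + of_int a) / of_int c)\<^sup>2 = of_int m"
proof -
  have "(2 * \<alpha>\<^sup>2 + of_int a)\<^sup>2 = 4 * (\<alpha>\<^sup>2 * \<alpha>\<^sup>2) + 4 * of_int a * \<alpha>\<^sup>2 + of_int (a\<^sup>2)"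
    by (simp add: power2_eq_square algebra_simps)
  also have "\<dots> = of_int (a\<^sup>2 - 4 * b)" unfolding square_square by (simp add: algebra_simps)
  also have "\<dots> = of_int c ^ 2 * of_int m" by (simp flip: assms(2))
  finally show ?thesis using assms(1) by (simp add: power_divide)
qed

end

section \<open>Valuations at 3 and tests for square factors\<close>

lemma padic_val_ge: "int p ^ n dvd c \<Longrightarrow> \<not> is_unit (int p) \<Longrightarrow> enat n \<le> \<nu> p c"
  by (auto simp: padic_val_def intro: multiplicity_geI)

lemma decompose_9:
  assumes "(c :: int) \<noteq> 0"
  obtains j n where "c = 9 ^ j * n" "\<not> 9 dvd n"
  using multiplicity_decompose'[of c 9] assms by (metis mult.commute zdvd1_eq numeral_eq_one_iff abs_numeral semiring_norm(86))

text \<open>The valuation of c is 2j or 2j + 1 according to whether 3 divides n. In the even case n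
  is the unit part; in the odd case n is not 1 modulo 3, so both sides fail.\<close>

lemma val_unit_part_3:
  assumes c: "c = 9 ^ j * n" "\<not> 9 dvd n"
  shows "(\<exists>k. k > 0 \<and> \<nu> 3 c = enat (2 * k)) \<and> [unit_part 3 c = 1] (mod 3) \<longleftrightarrow> j > 0 \<and> [n = 1] (mod 3)"
proof -
  have n0: "n \<noteq> 0" and c0: "c \<noteq> 0" using c by auto
  have 9: "(9::int) ^ j = 3 ^ (2 * j)" by (simp add: power_mult)
  show ?thesis
  proof (cases "3 dvd n")
    case False
    have "multiplicity 3 c = 2 * j"
      by (rule multiplicity_eqI) (use False in \<open>auto simp: c(1) 9\<close>)
    thus ?thesis using c0 by (auto simp: padic_val_def unit_part_def c(1) 9)
  next
    case True
    then obtain n' where n': "n = 3 * n'" by auto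
    have "multiplicity 3 c = 2 * j + 1"
      by (rule multiplicity_eqI) (use c(2) in \<open>auto simp: c(1) n' 9\<close>)
    hence "\<nu> 3 c \<noteq> enat (2 * k)" for k using c0 by (auto simp: padic_val_def) presburger
    moreover have "\<not> [n = 1] (mod 3)" using True unfolding cong_def by presburger
    ultimately show ?thesis by blast
  qed
qed

lemma index_cond1_iff:
  assumes "b = 9 ^ k * b'" "\<not> 9 dvd b'"
  shows "index_cond1 a b \<longleftrightarrow> [a = -1] (mod 3) \<and> k > 0 \<and> [b' = 1] (mod 3)"
  unfolding index_cond1_def using val_unit_part_3[OF assms] by blast

lemma index_cond2_iff:
  assumes "a\<^sup>2 - 4 * b = 9 ^ j * m" "\<not> 9 dvd m"
  shows "index_cond2 a b \<longleftrightarrow> [a = b] (mod 3) \<and> [b = 1] (mod 3) \<and> j > 0 \<and> [m = 1] (mod 3)"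
  unfolding index_cond2_def using val_unit_part_3[OF assms] by blast

text \<open>Write (r + u \<epsilon>)^2 = P + Q\<epsilon>. Multiplying its product with s +
  t\<epsilon> by the conjugate s - t\<epsilon> shows that 9 divides P and Q times the norm, so 3
  divides P and Q, and then r. Should 3 not divide u, then m is divisible by 3 exactly once and so
  is P; this forces 3 to divide s and t, hence 9 to divide the norm.\<close>

lemma sqfree_if_norm:
  assumes m: "\<not> 9 dvd m" and N: "\<not> 9 dvd s\<^sup>2 - m * t\<^sup>2"
  shows "sqfree_at_3 m s t"
  unfolding sqfree_at_3_def
proof (intro allI impI)
  fix r u
  assume 1: "9 dvd (r\<^sup>2 + m * u\<^sup>2) * s + 2 * r * u * t * m"
    and 2: "9 dvd (r\<^sup>2 + m * u\<^sup>2) * t + 2 * r * u * s"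
  define P Q where "P = r\<^sup>2 + m * u\<^sup>2" and "Q = 2 * r * u"
  have 1: "9 dvd P * s + Q * t * m" and 2: "9 dvd P * t + Q * s" using 1 2 by (simp_all add: P_def Q_def)
  have "9 dvd s * (P * s + Q * t * m) - m * t * (P * t + Q * s)" using 1 2 by (intro dvd_diff dvd_mult)
  hence PN: "9 dvd P * (s\<^sup>2 - m * t\<^sup>2)" by (simp add: algebra_simps power2_eq_square)
  have "9 dvd s * (P * t + Q * s) - t * (P * s + Q * t * m)" using 1 2 by (intro dvd_diff dvd_mult)
  hence QN: "9 dvd Q * (s\<^sup>2 - m * t\<^sup>2)" by (simp add: algebra_simps power2_eq_square)
  have P3: "3 dvd P" and Q3: "3 dvd Q" using PN QN N dvd_9_cancel by blast+
  have ru: "3 dvd r \<or> 3 dvd u" using Q3 by (simp add: Q_def prime_dvd_mult_3)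
  have r: "3 dvd r"
    using ru P3 by (auto simp: P_def dvd_add_left_iff prime_dvd_mult_3 power2_eq_square)
  moreover have "3 dvd u"
  proof (rule ccontr)
    assume u: "\<not> 3 dvd u"
    have "3 dvd m * u\<^sup>2" using P3 r by (simp add: P_def dvd_add_right_iff power2_eq_square)
    hence "3 dvd m" using u by (simp add: prime_dvd_mult_3 power2_eq_square)
    then obtain m' where m': "m = 3 * m'" by auto
    have m'3: "\<not> 3 dvd m'" using m unfolding m' by presburger
    obtain r' where r': "r = 3 * r'" using r by auto
    have P: "P = 3 * (3 * r'\<^sup>2 + m' * u\<^sup>2)" by (simp add: P_def r' m' power2_eq_square algebra_simps)
    have nd: "\<not> 3 dvd 3 * r'\<^sup>2 + m' * u\<^sup>2"
      using u m'3 by (simp add: dvd_add_right_iff prime_dvd_mult_3 power2_eq_square)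
    have P9: "\<not> 9 dvd P" using nd unfolding P by presburger
    have "3 dvd s\<^sup>2 - m * t\<^sup>2"
      using dvd_9_cancel[of "s\<^sup>2 - m * t\<^sup>2" P] PN P9 by (auto simp: mult.commute)
    hence "3 dvd s\<^sup>2" by (simp add: m' dvd_diff_left_iff mult.assoc)
    hence "3 dvd s" by (simp add: prime_dvd_mult_3 power2_eq_square)
    then obtain s' where s': "s = 3 * s'" by auto
    have "Q * s = 9 * (2 * r' * u * s')" by (simp add: Q_def r' s')
    hence "9 dvd P * t" using 2 by (metis dvd_add_left_iff dvd_triv_left)
    hence t: "3 dvd t" using dvd_9_cancel[of t P] P9 by (auto simp: mult.commute)
    then obtain t' where "t = 3 * t'" by auto
    hence "s\<^sup>2 - m * t\<^sup>2 = 9 * (s'\<^sup>2 - m * t'\<^sup>2)" by (simp add: s' power2_eq_square)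
    thus False using N by simp
  qed
  ultimately show "3 dvd r \<and> 3 dvd u" ..
qed

text \<open>Here s + t\<epsilon> is 3 times an element of norm prime to 3, and 3 is unramified in
  Q(\<epsilon>), so each place over 3 divides s + t\<epsilon> exactly once.\<close>

lemma sqfree_if_norm':
  assumes m: "\<not> 3 dvd m" and st: "3 dvd s" "3 dvd t" and N: "\<not> 27 dvd s\<^sup>2 - m * t\<^sup>2"
  shows "sqfree_at_3 m s t"
  unfolding sqfree_at_3_def
proof (intro allI impI)
  fix r u
  assume 1: "9 dvd (r\<^sup>2 + m * u\<^sup>2) * s + 2 * r * u * t * m"
    and 2: "9 dvd (r\<^sup>2 + m * u\<^sup>2) * t + 2 * r * u * s"
  define P Q where "P = r\<^sup>2 + m * u\<^sup>2" and "Q = 2 * r * u"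
  obtain s' t' where st': "s = 3 * s'" "t = 3 * t'" using st by (auto elim!: dvdE)
  have "s\<^sup>2 - m * t\<^sup>2 = 9 * (s'\<^sup>2 - m * t'\<^sup>2)" by (simp add: st' power2_eq_square)
  hence N': "\<not> 3 dvd s'\<^sup>2 - m * t'\<^sup>2" using N by presburger
  have "3 * 3 dvd 3 * (P * s' + Q * t' * m)" "3 * 3 dvd 3 * (P * t' + Q * s')"
    using 1 2 by (simp_all add: P_def Q_def st' algebra_simps)
  hence 1: "3 dvd P * s' + Q * t' * m" and 2: "3 dvd P * t' + Q * s'"
    by (simp_all only: dvd_mult_cancel_left, simp_all)
  have "3 dvd s' * (P * s' + Q * t' * m) - m * t' * (P * t' + Q * s')" using 1 2 by (intro dvd_diff dvd_mult)
  hence "3 dvd P * (s'\<^sup>2 - m * t'\<^sup>2)" by (simp add: algebra_simps power2_eq_square)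
  hence P3: "3 dvd P" using N' by (simp add: prime_dvd_mult_3)
  have "3 dvd s' * (P * t' + Q * s') - t' * (P * s' + Q * t' * m)" using 1 2 by (intro dvd_diff dvd_mult)
  hence "3 dvd Q * (s'\<^sup>2 - m * t'\<^sup>2)" by (simp add: algebra_simps power2_eq_square)
  hence "3 dvd Q" using N' by (simp add: prime_dvd_mult_3)
  hence "3 dvd r \<or> 3 dvd u" by (simp add: Q_def prime_dvd_mult_3)
  thus "3 dvd r \<and> 3 dvd u" using P3 m
    by (auto simp: P_def dvd_add_left_iff dvd_add_right_iff prime_dvd_mult_3 power2_eq_square)
qed

section \<open>The local cases at 3\<close>

context biquadratic_root
begin

abbreviation index_claim :: bool
  where "index_claim \<equiv>
    (3 dvd field_index (rat_adjoin \<alpha>) \<longleftrightarrow> index_cond1 a b \<or> index_cond2 a b) \<and>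
    (index_cond1 a b \<or> index_cond2 a b \<longrightarrow>
      \<not> monogenic (rat_adjoin \<alpha>) \<and> \<nu> 3 (int (field_index (rat_adjoin \<alpha>))) = 1)"

lemma b_nonzero: "b \<noteq> 0"
proof
  assume "b = 0"
  hence "\<alpha>\<^sup>2 * (\<alpha>\<^sup>2 + of_int a) = 0"
    using root by (simp add: power2_eq_square power4_eq_xxxx algebra_simps)
  hence "\<alpha>\<^sup>2 = 0 \<or> \<alpha>\<^sup>2 = - of_int a" by (auto simp: eq_neg_iff_add_eq_0)
  thus False using square_notin by auto
qed

lemma disc_nonzero: "a\<^sup>2 - 4 * b \<noteq> 0"
proof
  assume "a\<^sup>2 - 4 * b = 0"
  hence "((2 * \<alpha>\<^sup>2 + of_int a) / of_int 1)\<^sup>2 = of_int 0" by (intro eps_square) auto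
  hence "\<alpha>\<^sup>2 = - of_int a / 2" by (simp add: field_simps eq_neg_iff_add_eq_0)
  thus False using square_notin by auto
qed

lemma not_index_cond_if_3_dvd:
  assumes "3 dvd a" "3 dvd b"
  shows "\<not> index_cond1 a b" "\<not> index_cond2 a b"
  using assms unfolding index_cond1_def index_cond2_def cong_def by presburger+

text \<open>The multiplier 2 clears the denominator of
  \<open>\<alpha>\<^sup>2 = (- a + 3 ^ j * \<epsilon>) / 2\<close>.\<close>

lemma case_twice_alpha:
  assumes m: "a\<^sup>2 - 4 * b = 9 ^ j * m" "\<not> 9 dvd m"
    and sqfree: "sqfree_at_3 m (- 2 * a) (2 * 3 ^ j)"
    and C: "index_cond1 a b \<or> index_cond2 a b \<longleftrightarrow>
      [m = 1] (mod 3) \<and> [- 2 * a = 1] (mod 3) \<and> [(2 * 3 ^ j :: int) = 0] (mod 3)"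
  shows index_claim
proof (rule field_index_3_if_tower[OF _ _ _ _ _ refl _ refl _ m(2) sqfree C])
  let ?\<epsilon> = "(2 * \<alpha>\<^sup>2 + of_int a) / of_int (3 ^ j)"
  have "((3::int) ^ j)\<^sup>2 = 9 ^ j" by (simp flip: power_mult add: mult.commute[of j 2] power_mult)
  thus "?\<epsilon>\<^sup>2 = of_int m" by (intro eps_square) (auto simp: m(1))
  show "((2 + 0 * ?\<epsilon>) * \<alpha>)\<^sup>2 = of_int (- 2 * a) + of_int (2 * 3 ^ j) * ?\<epsilon>"
    by (simp add: power_mult_distrib)
qed auto

text \<open>\<open>\<alpha>\<^sup>2\<close> has norm b down to Q, so
  \<open>4 * \<alpha>\<^sup>2\<close> has norm 16b.\<close>

lemma norm_twice_alpha:
  assumes "a\<^sup>2 - 4 * b = 9 ^ j * m"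
  shows "(- 2 * a)\<^sup>2 - m * (2 * 3 ^ j)\<^sup>2 = 16 * b"
proof -
  have "m * (2 * 3 ^ j)\<^sup>2 = 4 * (9 ^ j * m)"
    by (simp add: power_mult_distrib flip: power_mult) (simp add: power_mult mult.commute[of j 2])
  also have "\<dots> = 4 * (a\<^sup>2 - 4 * b)" by (simp add: assms)
  finally show ?thesis by (simp add: power2_eq_square)
qed

lemma case_not_9_dvd_b:
  assumes "\<not> 9 dvd b"
  shows index_claim
proof -
  obtain j m where m: "a\<^sup>2 - 4 * b = 9 ^ j * m" "\<not> 9 dvd m" by (rule decompose_9[OF disc_nonzero])
  have N: "\<not> 9 dvd (- 2 * a)\<^sup>2 - m * (2 * 3 ^ j)\<^sup>2"
    using assms unfolding norm_twice_alpha[OF m(1)] by presburger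
  show ?thesis
  proof (rule case_twice_alpha[OF m sqfree_if_norm[OF m(2) N]])
    have "\<not> index_cond1 a b" using index_cond1_iff[of b 0 b a] assms by simp
    moreover have "[(2 * 3 ^ j :: int) = 0] (mod 3) \<longleftrightarrow> j > 0"
      by (cases j) (auto simp: cong_def mod_eq_0_iff_dvd)
    \<comment> \<open>If j > 0, then 3 divides \<open>a\<^sup>2 - 4 * b\<close>, so a = 1 modulo 3
      forces b = 1; and -2a is congruent to a.\<close>
    moreover have "[a = b] (mod 3) \<and> [b = 1] (mod 3) \<longleftrightarrow> [- 2 * a = 1] (mod 3)" if "j > 0"
    proof -
      have "3 dvd a\<^sup>2 - 4 * b" using that unfolding m(1) by (cases j) auto
      moreover have "a\<^sup>2 mod 3 = (a mod 3)\<^sup>2 mod 3" by (simp add: power_mod)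
      moreover have "a mod 3 = 0 \<or> a mod 3 = 1 \<or> a mod 3 = 2" by presburger
      ultimately show ?thesis unfolding cong_def by (elim disjE) (simp; presburger)+
    qed
    ultimately show "index_cond1 a b \<or> index_cond2 a b \<longleftrightarrow>
      [m = 1] (mod 3) \<and> [- 2 * a = 1] (mod 3) \<and> [(2 * 3 ^ j :: int) = 0] (mod 3)"
      using index_cond2_iff[OF m] by blast
  qed
qed

text \<open>There are two places of \<open>\<rat>(\<alpha>\<^sup>2)\<close> over \<open>3\<close>. At one of them \<open>\<alpha>\<^sup>2\<close> is a unit and \<open>\<delta>\<close> is
  divisible by \<open>3\<^sup>k\<close>; at the other one \<open>\<alpha>\<close> is divisible by \<open>3\<^sup>k\<close>, and \<open>\<delta>\<close> is \<open>\<alpha> / 3\<^sup>k\<close> times a unit. So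
  \<open>\<eta> = 2 (\<alpha> + \<delta>)\<close> removes the square factors of \<open>\<alpha>\<^sup>2\<close>.\<close>

lemma case_9_dvd_b_not_3_dvd_a:
  assumes a: "\<not> 3 dvd a" and b: "9 dvd b"
  shows index_claim
proof -
  obtain k b' where b': "b = 9 ^ k * b'" "\<not> 9 dvd b'" by (rule decompose_9[OF b_nonzero])
  have k: "k > 0" using b b' by (cases k) auto
  define m where "m = a\<^sup>2 - 4 * b"
  define \<epsilon> where "\<epsilon> = (2 * \<alpha>\<^sup>2 + of_int a) / of_int 1"
  define \<delta> where "\<delta> = \<alpha> * (\<alpha>\<^sup>2 + of_int a) / 3 ^ k"
  define s t where "s = - 2 * a - 2 * a * b' - 8 * 3 ^ k * b'" and "t = 2 - 2 * b'"
  have 9: "(9::int) ^ k = (3 ^ k)\<^sup>2" by (simp flip: power_mult add: mult.commute[of k 2] power_mult)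
  have ninec: "(9::complex) ^ k = (3 ^ k)\<^sup>2" by (simp flip: power_mult add: mult.commute[of k 2] power_mult)
  have "\<alpha> * \<delta> = \<alpha>\<^sup>2 * (\<alpha>\<^sup>2 + of_int a) / 3 ^ k" by (simp add: \<delta>_def power2_eq_square)
  also have "\<dots> = - of_int (3 ^ k * b')" unfolding square_mult by (simp add: b'(1) ninec power2_eq_square)
  finally have \<alpha>\<delta>: "\<alpha> * \<delta> = - of_int (3 ^ k * b')" .
  have "\<delta>\<^sup>2 = \<alpha>\<^sup>2 * (\<alpha>\<^sup>2 + of_int a) * (\<alpha>\<^sup>2 + of_int a) / 9 ^ k"
    by (simp add: \<delta>_def ninec power2_eq_square)
  also have "\<dots> = - of_int b' * (\<alpha>\<^sup>2 + of_int a)" unfolding square_mult by (simp add: b'(1))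
  finally have \<delta>\<delta>: "\<delta>\<^sup>2 = - of_int b' * (\<alpha>\<^sup>2 + of_int a)" .
  have "a mod 3 = 1 \<or> a mod 3 = 2" using a by presburger
  moreover have "a\<^sup>2 mod 3 = (a mod 3)\<^sup>2 mod 3" by (simp add: power_mod)
  ultimately have a2: "a\<^sup>2 mod 3 = 1" by auto
  have m3: "m mod 3 = 1" using a2 b unfolding m_def by presburger
  hence m9: "\<not> 9 dvd m" by presburger
  have N: "\<not> 9 dvd s\<^sup>2 - m * t\<^sup>2"
  proof
    \<comment> \<open>E is the cofactor of 16b' in the norm of s + t\<epsilon>. All its terms except
      \<open>a\<^sup>2\<close> contain \<open>3 ^ k\<close>, so E is prime to 3.\<close>
    define E where "E = a\<^sup>2 + 2 * a * 3 ^ k * (1 + b') + 4 * 9 ^ k * b' + 9 ^ k * (1 - b')\<^sup>2"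
    have "s\<^sup>2 - m * t\<^sup>2 = 16 * b' * E"
      unfolding s_def t_def m_def E_def b'(1) 9 by (simp add: algebra_simps power2_eq_square)
    moreover assume "9 dvd s\<^sup>2 - m * t\<^sup>2"
    ultimately have "9 dvd E * (16 * b')" by (simp add: mult_ac)
    moreover have E: "\<not> 3 dvd E"
    proof -
      obtain i where "k = Suc i" using k by (cases k) auto
      hence "E = a\<^sup>2 + 3 * (2 * a * 3 ^ i * (1 + b') + 12 * 9 ^ i * b' + 3 * 9 ^ i * (1 - b')\<^sup>2)"
        by (simp add: E_def algebra_simps)
      thus ?thesis using a2 by presburger
    qed
    ultimately have "9 dvd 16 * b'" using dvd_9_cancel[OF _ E] by blast
    thus False using b'(2) by presburger
  qed
  have "3 dvd (3::int) ^ k" using k by (cases k) auto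
  hence s3: "[s = - 2 * a - 2 * a * b'] (mod 3)"
    by (simp add: s_def cong_iff_dvd_diff)
  have C: "index_cond1 a b \<or> index_cond2 a b \<longleftrightarrow>
      [m = 1] (mod 3) \<and> [s = 1] (mod 3) \<and> [t = 0] (mod 3)"
  proof -
    have "\<not> index_cond2 a b" using b unfolding index_cond2_def cong_def by presburger
    moreover have "[m = 1] (mod 3)" using m3 by (simp add: cong_def)
    moreover have "[t = 0] (mod 3) \<longleftrightarrow> [b' = 1] (mod 3)" unfolding t_def cong_def by presburger
    moreover have "[s = 1] (mod 3) \<longleftrightarrow> [a = -1] (mod 3)" if "[b' = 1] (mod 3)"
    proof -
      have "[- 2 * a - 2 * a * b' = - 2 * a - 2 * a * 1] (mod 3)"
        by (intro cong_diff cong_mult cong_refl that)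
      also have "[- 2 * a - 2 * a * 1 = - a] (mod 3)" by (simp add: cong_iff_dvd_diff)
      finally have "[s = - a] (mod 3)" by (rule cong_trans[OF s3])
      hence "[s = 1] (mod 3) \<longleftrightarrow> [- a = 1] (mod 3)" by (meson cong_sym cong_trans)
      also have "\<dots> \<longleftrightarrow> [a = -1] (mod 3)" using cong_minus_minus_iff[of a "-1" 3] by simp
      finally show ?thesis .
    qed
    ultimately show ?thesis using index_cond1_iff[OF b', of a] k by blast
  qed
  show ?thesis
  proof (rule field_index_3_if_tower[OF _ _ _ _ _ \<epsilon>_def _ refl _ m9 sqfree_if_norm[OF m9 N] C])
    show "\<epsilon>\<^sup>2 = of_int m" unfolding \<epsilon>_def by (rule eps_square) (auto simp: m_def)
    \<comment> \<open>The multiplier comes from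
      \<open>\<alpha>\<^sup>2 + a = (\<epsilon> + a) / 2\<close>, which makes
      \<open>2 * \<delta>\<close> equal to \<alpha>(\<epsilon> + a) / \<open>3 ^ k\<close>.\<close>
    have "(2 + of_int a / 3 ^ k + 1 / 3 ^ k * \<epsilon>) * \<alpha> = 2 * (\<alpha> + \<delta>)"
      by (simp add: \<epsilon>_def \<delta>_def add_divide_distrib algebra_simps power2_eq_square)
    hence "((2 + of_int a / 3 ^ k + 1 / 3 ^ k * \<epsilon>) * \<alpha>)\<^sup>2 = 4 * (\<alpha>\<^sup>2 + 2 * (\<alpha> * \<delta>) + \<delta>\<^sup>2)"
      by (simp add: power2_eq_square algebra_simps)
    also have "\<dots> = of_int s + of_int t * \<epsilon>"
      unfolding \<alpha>\<delta> \<delta>\<delta> s_def t_def \<epsilon>_def by (simp add: algebra_simps)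
    finally show "((2 + of_int a / 3 ^ k + 1 / 3 ^ k * \<epsilon>) * \<alpha>)\<^sup>2 = of_int s + of_int t * \<epsilon>" .
  qed auto
qed

text \<open>Taking \<eta> = 2\<alpha> suffices: s and t are both divisible by 3, while the norm 16b
  is not divisible by 27. Neither index condition can hold, and s is not 1 modulo 3.\<close>

lemma case_ramified_unit:
  assumes a: "3 dvd a" and b: "9 dvd b" "\<not> 27 dvd b"
    and m: "a\<^sup>2 - 4 * b = 9 ^ j * m" "\<not> 3 dvd m"
  shows index_claim
proof -
  have j: "3 dvd (3 :: int) ^ j"
  proof (cases j)
    case 0
    have "9 dvd a\<^sup>2" using a by (auto elim!: dvdE simp: power2_eq_square)
    hence "9 dvd m" using b(1) m(1) 0 by (metis dvd_diff dvd_mult mult_1 power_0)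
    thus ?thesis using m(2) by presburger
  qed auto
  have m9: "\<not> 9 dvd m" using m(2) by presburger
  have N: "\<not> 27 dvd (- 2 * a)\<^sup>2 - m * (2 * 3 ^ j)\<^sup>2"
    using b(2) unfolding norm_twice_alpha[OF m(1)] by presburger
  show ?thesis
  proof (rule case_twice_alpha[OF m(1) m9 sqfree_if_norm'[OF m(2) _ _ N]])
    have "3 dvd b" using b(1) by presburger
    moreover have "\<not> [- 2 * a = 1] (mod 3)" using a unfolding cong_def by presburger
    ultimately show "index_cond1 a b \<or> index_cond2 a b \<longleftrightarrow>
      [m = 1] (mod 3) \<and> [- 2 * a = 1] (mod 3) \<and> [(2 * 3 ^ j :: int) = 0] (mod 3)"
      using not_index_cond_if_3_dvd[OF a] by blast
  qed (use a j in auto)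
qed

text \<open>Now 3 ramifies in Q(\<epsilon>) with uniformizer \<epsilon>, and 3 divides
  \<open>2 * \<alpha>\<^sup>2\<close>, so \<alpha> should be divided by \<epsilon>. The multiplier
  \<open>2 / 3 * \<epsilon>\<close> does this, as \<epsilon> / 3 = m' / \<epsilon>. The new norm is
  16b' times a unit at 3, where 9 does not divide b' = b / 9.\<close>

lemma case_ramified_3_dvd_m:
  assumes a: "3 dvd a" and b: "9 dvd b" "\<not> 81 dvd b"
    and m: "a\<^sup>2 - 4 * b = 9 ^ j * m" "\<not> 9 dvd m" "3 dvd m"
  shows index_claim
proof -
  obtain a' where a': "a = 3 * a'" using a by auto
  obtain b' where b': "b = 9 * b'" using b(1) by auto
  obtain m' where m': "m = 3 * m'" using m(3) by auto
  have m'3: "\<not> 3 dvd m'" using m(2) unfolding m' by presburger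
  obtain i where i: "j = Suc i"
  proof (cases j)
    case 0
    hence "m = 9 * (a'\<^sup>2 - 4 * b')" using m(1) by (simp add: a' b' power2_eq_square)
    thus ?thesis using m(2) by simp
  qed blast
  have e: "a'\<^sup>2 - 4 * b' = 9 ^ i * m" using m(1) by (simp add: a' b' i power2_eq_square)
  define \<epsilon> where "\<epsilon> = (2 * \<alpha>\<^sup>2 + of_int a) / of_int (3 ^ j)"
  define s t where "s = - 2 * m' * a'" and "t = 2 * m' * 3 ^ i"
  have 9: "((3::int) ^ n)\<^sup>2 = 9 ^ n" for n by (simp flip: power_mult add: mult.commute[of n 2] power_mult)
  have eps: "\<epsilon>\<^sup>2 = of_int m" unfolding \<epsilon>_def by (rule eps_square) (auto simp: 9 m(1))
  have N: "\<not> 9 dvd s\<^sup>2 - m * t\<^sup>2"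
  proof
    have "s\<^sup>2 - m * t\<^sup>2 = 4 * m'\<^sup>2 * (a'\<^sup>2 - 9 ^ i * m)"
      by (simp add: s_def t_def power_mult_distrib 9 algebra_simps)
    also have "\<dots> = m' * (m' * (16 * b'))" unfolding e[symmetric] by (simp add: power2_eq_square)
    finally have eq: "s\<^sup>2 - m * t\<^sup>2 = m' * (m' * (16 * b'))" .
    assume "9 dvd s\<^sup>2 - m * t\<^sup>2"
    hence "9 dvd 16 * b'" unfolding eq using dvd_9_cancel[OF dvd_9_cancel[OF _ m'3] m'3] by blast
    hence "9 dvd b'" using dvd_9_cancel[of 16 b'] by simp
    hence "9 * 9 dvd 9 * b'" by (intro mult_dvd_mono) auto
    thus False using b(2) by (simp add: b')
  qed
  show ?thesis
  proof (rule field_index_3_if_tower[OF _ _ _ _ _ \<epsilon>_def eps refl _ m(2) sqfree_if_norm[OF m(2) N]])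
    have "((0 + 2 / 3 * \<epsilon>) * \<alpha>)\<^sup>2 = 4 / 9 * (\<epsilon>\<^sup>2 * \<alpha>\<^sup>2)" by (simp add: power2_eq_square)
    also have "\<alpha>\<^sup>2 = (of_int (3 ^ j) * \<epsilon> - of_int a) / 2" by (simp add: \<epsilon>_def)
    also have "4 / 9 * (\<epsilon>\<^sup>2 * ((of_int (3 ^ j) * \<epsilon> - of_int a) / 2)) = of_int s + of_int t * \<epsilon>"
      unfolding eps by (simp add: s_def t_def m' a' i field_simps)
    finally show "((0 + 2 / 3 * \<epsilon>) * \<alpha>)\<^sup>2 = of_int s + of_int t * \<epsilon>" .
    have "3 dvd b" using b(1) by presburger
    moreover have "\<not> [m = 1] (mod 3)" using m(3) unfolding cong_def by presburger
    ultimately show "index_cond1 a b \<or> index_cond2 a b \<longleftrightarrow> [m = 1] (mod 3) \<and> [s = 1] (mod 3) \<and> [t = 0] (mod 3)"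
      using not_index_cond_if_3_dvd[OF a] by blast
  qed auto
qed

text \<open>The sign \<open>\<sigma>\<close> keeps \<open>\<alpha>\<close> and \<open>\<sigma> \<delta>\<close> from cancelling at the place where \<open>a\<close> and \<open>\<alpha>\<^sup>2\<close> have
  the same valuation.\<close>

lemma case_ramified_deep:
  assumes a: "3 dvd a" "\<not> 9 dvd a" and b: "27 dvd b"
  shows index_claim
proof -
  obtain a' where a': "a = 3 * a'" using a by auto
  have a'3: "\<not> 3 dvd a'" using a(2) unfolding a' by presburger
  obtain c where c: "b = 3 * c" "9 dvd c" using b by (auto elim!: dvdE intro: that)
  have "c \<noteq> 0" using b_nonzero c by auto
  then obtain k b' where k: "c = 9 ^ k * b'" and b'9: "\<not> 9 dvd b'" by (rule decompose_9)
  obtain i where i: "k = Suc i" using c(2) k b'9 by (cases k) auto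
  define h :: int where "h = 3 ^ i"
  have 9: "((3::int) ^ i)\<^sup>2 = 9 ^ i" by (simp flip: power_mult add: mult.commute[of i 2] power_mult)
  have b': "b = 27 * h\<^sup>2 * b'" unfolding c(1) k i h_def 9 by simp
  define m where "m = a'\<^sup>2 - 12 * h\<^sup>2 * b'"
  define \<epsilon> where "\<epsilon> = (2 * \<alpha>\<^sup>2 + of_int a) / of_int 3"
  have eps: "\<epsilon>\<^sup>2 = of_int m" unfolding \<epsilon>_def by (rule eps_square) (auto simp: m_def a' b' power2_eq_square)
  \<comment> \<open>The two candidates sum to 2a', so 3 cannot divide both.\<close>
  obtain \<sigma> :: int where \<sigma>: "\<sigma> = 1 \<or> \<sigma> = -1" "\<not> 3 dvd a' + \<sigma> * (h * b')"
  proof (cases "3 dvd a' + h * b'")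
    case True
    hence "\<not> 3 dvd a' + (-1) * (h * b')" using a'3 by presburger
    thus ?thesis using that by blast
  next
    case False
    thus ?thesis using that[of 1] by simp
  qed
  have \<sigma>2: "\<sigma> * \<sigma> = 1" "\<sigma> * (\<sigma> * z) = z" for z using \<sigma>(1) by auto
  \<comment> \<open>Since \<open>b = 27 * h\<^sup>2 * b'\<close> and
    \<open>\<alpha>\<^sup>2 + a = 3 / 2 * (\<epsilon> + a')\<close>, this denominator makes
    \<open>\<delta>\<^sup>2\<close> equal to -b'(\<epsilon> + a') / 2.\<close>
  define \<delta> where "\<delta> = \<alpha> * (\<alpha>\<^sup>2 + of_int a) / of_int (9 * h)"
  define s t where "s = - 6 * a' - 2 * a' * b' - 24 * \<sigma> * h * b'" and "t = 6 - 2 * b'"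
  have h0: "h \<noteq> 0" by (simp add: h_def)
  have "\<alpha> * \<delta> = \<alpha>\<^sup>2 * (\<alpha>\<^sup>2 + of_int a) / of_int (9 * h)" by (simp add: \<delta>_def power2_eq_square)
  also have "\<dots> = - of_int (3 * h * b')" unfolding square_mult using h0 by (simp add: b' power2_eq_square field_simps)
  finally have \<alpha>\<delta>: "\<alpha> * \<delta> = - of_int (3 * h * b')" .
  have "\<delta>\<^sup>2 = \<alpha>\<^sup>2 * (\<alpha>\<^sup>2 + of_int a) * (\<alpha>\<^sup>2 + of_int a) / of_int ((9 * h)\<^sup>2)"
    by (simp add: \<delta>_def power2_eq_square)
  also have "\<dots> = - of_int b' * (\<alpha>\<^sup>2 + of_int a) / 3"
    unfolding square_mult using h0 by (simp add: b' power2_eq_square field_simps)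
  finally have \<delta>\<delta>: "\<delta>\<^sup>2 = - of_int b' * (\<alpha>\<^sup>2 + of_int a) / 3" .
  \<comment> \<open>Cofactor of 48b' in the norm of s + t\<epsilon>; modulo 3 it is the square of a'
    + \<sigma>hb', a unit by the choice of \<sigma>.\<close>
  define E where "E = a'\<^sup>2 + 2 * \<sigma> * h * a' * (3 + b') + 12 * h\<^sup>2 * b' + h\<^sup>2 * (3 - b')\<^sup>2"
  have N: "s\<^sup>2 - m * t\<^sup>2 = 48 * b' * E"
    unfolding s_def t_def m_def E_def using \<sigma>2 by (simp add: algebra_simps power2_eq_square)
  have E: "\<not> 3 dvd E"
  proof -
    have "E = (a' + \<sigma> * (h * b')) * (a' + \<sigma> * (h * b')) + 3 * (2 * \<sigma> * h * a' + 4 * h\<^sup>2 * b' + h\<^sup>2 * (3 - 2 * b'))"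
      using \<sigma>2 by (simp add: E_def algebra_simps power2_eq_square)
    moreover have "\<not> 3 dvd (a' + \<sigma> * (h * b')) * (a' + \<sigma> * (h * b'))" using \<sigma>(2) by (simp add: prime_dvd_mult_3)
    ultimately show ?thesis by presburger
  qed
  have "a' mod 3 = 1 \<or> a' mod 3 = 2" using a'3 by presburger
  moreover have "a'\<^sup>2 mod 3 = (a' mod 3)\<^sup>2 mod 3" by (simp add: power_mod)
  ultimately have a2: "a'\<^sup>2 mod 3 = 1" by auto
  have "m = a'\<^sup>2 + 3 * (- 4 * h\<^sup>2 * b')" by (simp add: m_def)
  hence "m mod 3 = 1" using a2 by (simp only: mod_mult_self2)
  hence m3: "\<not> 3 dvd m" and m9: "\<not> 9 dvd m" by presburger+
  \<comment> \<open>The norm \<open>48 * b' * E\<close> has valuation 1 at 3 if b' is prime to 3.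
    Otherwise it has valuation 2, and s and t are both divisible by 3, so the second test
    applies.\<close>
  have sqfree: "sqfree_at_3 m s t"
  proof (cases "3 dvd b'")
    case True
    have "\<not> 27 dvd s\<^sup>2 - m * t\<^sup>2"
    proof
      assume "27 dvd s\<^sup>2 - m * t\<^sup>2"
      moreover have "s\<^sup>2 - m * t\<^sup>2 = 3 * (E * (16 * b'))" by (simp add: N)
      ultimately have "3 * 9 dvd 3 * (E * (16 * b'))" by simp
      hence "9 dvd E * (16 * b')" by (subst (asm) dvd_mult_cancel_left) simp
      hence "9 dvd 16 * b'" using dvd_9_cancel[OF _ E] by blast
      thus False using b'9 by presburger
    qed
    moreover have "3 dvd s" "3 dvd t" using True by (auto simp: s_def t_def)
    ultimately show ?thesis using sqfree_if_norm'[OF m3] by blast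
  next
    case False
    have "\<not> 9 dvd s\<^sup>2 - m * t\<^sup>2"
    proof
      assume "9 dvd s\<^sup>2 - m * t\<^sup>2"
      moreover have "s\<^sup>2 - m * t\<^sup>2 = 3 * (16 * (b' * E))" by (simp add: N)
      ultimately have "3 * 3 dvd 3 * (16 * (b' * E))" by simp
      hence "3 dvd 16 * (b' * E)" by (subst (asm) dvd_mult_cancel_left) simp
      hence "3 dvd b' * E" by presburger
      thus False using E False by (simp add: prime_dvd_mult_3)
    qed
    thus ?thesis using sqfree_if_norm[OF m9] by blast
  qed
  show ?thesis
  proof (rule field_index_3_if_tower[OF _ _ _ _ _ \<epsilon>_def eps refl _ m9 sqfree])
    let ?x = "2 + of_int (\<sigma> * a') / of_int (3 * h) :: complex" and ?y = "of_int \<sigma> / of_int (3 * h) :: complex"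
    have "\<alpha>\<^sup>2 + of_int a = 3 / 2 * (\<epsilon> + of_int a')" by (simp add: \<epsilon>_def a')
    hence "(?x + ?y * \<epsilon>) * \<alpha> = 2 * (\<alpha> + of_int \<sigma> * \<delta>)"
      unfolding \<delta>_def using h0 by (simp add: add_divide_distrib algebra_simps power2_eq_square)
    hence "((?x + ?y * \<epsilon>) * \<alpha>)\<^sup>2 = 4 * (\<alpha>\<^sup>2 + 2 * of_int \<sigma> * (\<alpha> * \<delta>) + of_int (\<sigma> * \<sigma>) * \<delta>\<^sup>2)"
      by (simp add: power2_eq_square algebra_simps)
    also have "\<dots> = of_int s + of_int t * \<epsilon>"
    proof -
      have \<epsilon>3: "3 * \<epsilon> = 2 * \<alpha>\<^sup>2 + 3 * of_int a'" by (simp add: \<epsilon>_def a')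
      have \<delta>3: "3 * \<delta>\<^sup>2 = - of_int b' * (\<alpha>\<^sup>2 + 3 * of_int a')" using \<delta>\<delta> by (simp add: a')
      have "3 * (4 * (\<alpha>\<^sup>2 + 2 * of_int \<sigma> * (\<alpha> * \<delta>) + of_int (\<sigma> * \<sigma>) * \<delta>\<^sup>2))
          = 12 * \<alpha>\<^sup>2 + 24 * of_int \<sigma> * (\<alpha> * \<delta>) + 4 * (3 * \<delta>\<^sup>2)"
        unfolding \<sigma>2(1) by (simp add: distrib_left)
      also have "\<dots> = 3 * of_int s + of_int t * (3 * \<epsilon>)"
        unfolding \<alpha>\<delta> \<delta>3 \<epsilon>3 s_def t_def by (simp add: algebra_simps)
      also have "\<dots> = 3 * (of_int s + of_int t * \<epsilon>)" by (simp add: distrib_left)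
      finally show ?thesis unfolding mult_cancel_left by simp
    qed
    finally show "((?x + ?y * \<epsilon>) * \<alpha>)\<^sup>2 = of_int s + of_int t * \<epsilon>" .
    show "?x \<noteq> 0 \<or> ?y \<noteq> 0" using \<sigma>(1) h0 by auto
    have "3 dvd b" using b by presburger
    moreover have "\<not> ([s = 1] (mod 3) \<and> [t = 0] (mod 3))"
    proof
      assume st: "[s = 1] (mod 3) \<and> [t = 0] (mod 3)"
      hence "3 dvd b'" unfolding t_def cong_def by presburger
      hence "3 dvd s" by (simp add: s_def)
      thus False using st unfolding cong_def by presburger
    qed
    ultimately show "index_cond1 a b \<or> index_cond2 a b \<longleftrightarrow> [m = 1] (mod 3) \<and> [s = 1] (mod 3) \<and> [t = 0] (mod 3)"
      using not_index_cond_if_3_dvd[OF a(1)] by blast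
  qed auto
qed

lemma index_claim_holds:
  assumes val: "\<not> (9 dvd a \<and> 81 dvd b)"
  shows index_claim
proof (cases "9 dvd b")
  case False
  thus ?thesis by (rule case_not_9_dvd_b)
next
  case b: True
  show ?thesis
  proof (cases "3 dvd a")
    case False
    thus ?thesis using b by (rule case_9_dvd_b_not_3_dvd_a)
  next
    case a: True
    show ?thesis
    proof (cases "27 dvd b \<and> \<not> 9 dvd a")
      case True
      thus ?thesis using a by (intro case_ramified_deep) auto
    next
      case False
      \<comment> \<open>Either 27 does not divide b already, or 9 divides a and \<open>val\<close>
        applies.\<close>
      hence b81: "\<not> 81 dvd b" using val by presburger
      obtain j m where m: "a\<^sup>2 - 4 * b = 9 ^ j * m" "\<not> 9 dvd m" by (rule decompose_9[OF disc_nonzero])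
      show ?thesis
      proof (cases "3 dvd m")
        case True
        from case_ramified_3_dvd_m[OF a b b81 m True] show ?thesis .
      next
        case m3: False
        \<comment> \<open>Otherwise 9 divides a and 27 divides b exactly, so
          \<open>a\<^sup>2 - 4 * b\<close> has odd valuation 3 and m would be divisible by
          3.\<close>
        have "\<not> 27 dvd b"
        proof
          assume b27: "27 dvd b"
          hence a9: "9 dvd a" using False by blast
          then obtain a' where a': "a = 9 * a'" by auto
          obtain b' where b': "b = 27 * b'" using b27 by auto
          have nb: "\<not> 3 dvd b'" using b81 unfolding b' by presburger
          have e: "9 ^ j * m = 27 * (3 * a'\<^sup>2 - 4 * b')" unfolding m(1)[symmetric] by (simp add: a' b' power2_eq_square)
          hence "27 dvd 9 ^ j * m" by simp
          consider "j = 0" | "j = 1" | i where "j = Suc (Suc i)" by (metis One_nat_def nat.exhaust)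
          thus False
          proof cases
            case 1
            thus False using e m(2) by simp
          next
            case 2
            hence "m = 3 * (3 * a'\<^sup>2 - 4 * b')" using e by simp
            thus False using m3 by simp
          next
            case 3
            hence "3 * (9 ^ i * m) = 3 * a'\<^sup>2 - 4 * b'" using e by simp
            thus False using nb by presburger
          qed
        qed
        from case_ramified_unit[OF a b this m(1) m3] show ?thesis .
      qed
    qed
  qed
qed

end

theorem theorem2p3:
  fixes a b :: int and F :: "int poly" and \<alpha> :: complex and K :: "complex set"
  assumes F: "F = [:b, 0, a, 0, 1:]"
    and irred: "Factorial_Ring.irreducible (map_poly rat_of_int F)"
    and val: "\<forall>p::nat. Factorial_Ring.prime p \<longrightarrow> \<nu> p a < 2 \<or> \<nu> p b < 4"
    and root: "poly (map_poly of_int F) \<alpha> = 0"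
    and K: "K = rat_adjoin \<alpha>"
  shows "(3 dvd field_index K \<longleftrightarrow> index_cond1 a b \<or> index_cond2 a b)
       \<and> (index_cond1 a b \<or> index_cond2 a b \<longrightarrow> \<not> monogenic K \<and> \<nu> 3 (int (field_index K)) = 1)"
proof -
  let ?F = "map_poly rat_of_int F"
  have deg: "degree ?F = 4" by (simp add: F degree_map_poly)
  have root': "poly (map_poly of_rat ?F) \<alpha> = 0"
    using root by (simp add: F map_poly_pCons)
  note nonzero = of_rat_poly_root_nonzero[OF irred root', unfolded deg]
  interpret biquadratic_root a b \<alpha>
  proof
    show "\<alpha> ^ 4 + of_int a * \<alpha>\<^sup>2 + of_int b = 0"
      using root by (simp add: F map_poly_pCons algebra_simps power2_eq_square power4_eq_xxxx)
    show "\<alpha>\<^sup>2 \<notin> \<rat>"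
    proof
      assume "\<alpha>\<^sup>2 \<in> \<rat>"
      then obtain p where "\<alpha>\<^sup>2 = of_rat p" by (auto elim: Rats_cases)
      thus False using nonzero[of "[:- p, 0, 1:]"]
        by (simp add: map_poly_pCons power2_eq_square of_rat_minus)
    qed
    show "\<alpha> \<noteq> p + q * \<alpha>\<^sup>2" if pq: "p \<in> \<rat>" "q \<in> \<rat>" for p q
    proof
      assume eq: "\<alpha> = p + q * \<alpha>\<^sup>2"
      obtain p' q' where "p = of_rat p'" "q = of_rat q'" using pq by (auto elim!: Rats_cases)
      thus False using nonzero[of "[:p', -1, q':]"] eq
        by (cases "q' = 0") (simp_all add: map_poly_pCons power2_eq_square of_rat_minus algebra_simps)
    qed
  qed
  \<comment> \<open>The valuation hypothesis at p = 3; if a = 0, then \<open>\<nu> 3 a\<close> is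
    infinite, in accordance with 9 dividing 0.\<close>
  have "\<not> (9 dvd a \<and> 81 dvd b)"
  proof
    assume "9 dvd a \<and> 81 dvd b"
    hence "enat 2 \<le> \<nu> 3 a" "enat 4 \<le> \<nu> 3 b" by (auto intro!: padic_val_ge)
    moreover have "\<nu> 3 a < 2 \<or> \<nu> 3 b < 4" using val by simp
    ultimately show False by (auto simp: numeral_eq_enat leD)
  qed
  thus ?thesis unfolding K by (rule index_claim_holds)
qed

end
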